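(* Let $n\ge 1$, $p>1$ and $q=\frac{p}{p-1}$. Every smooth and rapidly decaying positive function $u:\mathbb{R}^n\to(0,\infty)$ with $\|u^{p-1}\|_{L^1(\mathbb{R}^n)}=1$ satisfies $$N_p(u)\,I_p(u)\;\ge\; N_p(\widetilde G_p)\,I_p(\widetilde G_p)=\gamma_{n,p},$$ where $$\gamma_{n,p}=n(qe)^{p-1}\pi^{\frac p2}\left[\frac{\Gamma\left(\frac n2+1\right)}{\Gamma\left(\frac nq+1\right)}\right]^{-\frac pn}$$ and $$\widetilde G_p(x)=\left(C_{p,n}\,e^{-\frac{p-1}{p^q}|x|^q}\right)^{\frac1{p-1}},\qquad C_{p,n}=\left(p^{\frac1p}q^{\frac1q}\right)^{-n}\pi^{-\frac n2}\frac{\Gamma\left(\frac n2+1\right)}{\Gamma\left(\frac nq+1\right)} .$$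
   Context: For a positive function $u$ on $\mathbb{R}^n$: the $p$-entropy is $H_p(u)=-\int_{\mathbb{R}^n}u^{p-1}\log u^{p-1}\,dx$, the $p$-entropy power is $N_p(u)=\exp\left(\frac pn H_p(u)\right)$, and the $p$-Fisher information is $I_p(u)=(p-1)^p\int_{\mathbb{R}^n}\frac{|\nabla u|^p}{u}\,dx\in[0,\infty]$. $\Gamma$ is the Euler Gamma function. "Rapidly decaying" is read in the usual (Schwartz) sense: $u$ and all its derivatives decay faster than any power of $|x|$. *)

theory Defs
  imports "HOL-Analysis.Analysis"
begin

definition partial :: "'n::finite \<Rightarrow> (real^'n \<Rightarrow> real) \<Rightarrow> real^'n \<Rightarrow> real" where
  "partial i f = (\<lambda>x. frechet_derivative f (at x) (axis i 1))"

(* A multi-index is given as the list of the coordinates in which one differentiates. *)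
definition iterated_partial :: "'n::finite list \<Rightarrow> (real^'n \<Rightarrow> real) \<Rightarrow> real^'n \<Rightarrow> real" where
  "iterated_partial is f = foldr partial is f"

(* C^infinity: partial derivatives of all orders exist and are (Frechet) differentiable,
   hence continuous. The empty list covers f itself. *)
definition smooth :: "(real^'n::finite \<Rightarrow> real) \<Rightarrow> bool" where
  "smooth f \<longleftrightarrow> (\<forall>is x. iterated_partial is f differentiable (at x))"

(* Finiteness of all Schwartz seminorms; meaningful for smooth f only. *)
definition rapidly_decaying :: "(real^'n::finite \<Rightarrow> real) \<Rightarrow> bool" where
  "rapidly_decaying f \<longleftrightarrow>
     (\<forall>is. \<forall>k::nat. bounded (range (\<lambda>x. norm x ^ k * iterated_partial is f x)))"

definition gradient :: "('a::real_inner \<Rightarrow> real) \<Rightarrow> 'a \<Rightarrow> 'a" where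
  "gradient f x = (THE D. GDERIV f x :> D)"

(* The Bochner integral is 0 for non-integrable integrands, but no such case arises here:
   for rapidly decaying positive u and p > 1, and for the functions G_tilde p,
   the integrand is integrable. *)
definition p_entropy :: "real \<Rightarrow> (real^'n::finite \<Rightarrow> real) \<Rightarrow> real" where
  "p_entropy p u = - (\<integral>x. u x powr (p - 1) * ln (u x powr (p - 1)) \<partial>lborel)"

definition p_entropy_power :: "real \<Rightarrow> (real^'n::finite \<Rightarrow> real) \<Rightarrow> real" where
  "p_entropy_power p u = exp (p / real CARD('n) * p_entropy p u)"

definition p_Fisher :: "real \<Rightarrow> (real^'n::finite \<Rightarrow> real) \<Rightarrow> ennreal" where
  "p_Fisher p u = ennreal ((p - 1) powr p) *
     (\<integral>\<^sup>+x. ennreal (norm (gradient u x) powr p / u x) \<partial>lborel)"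

definition conj_exponent :: "real \<Rightarrow> real" where
  "conj_exponent p = p / (p - 1)"

definition C_const :: "real \<Rightarrow> nat \<Rightarrow> real" where
  "C_const p n = (let q = conj_exponent p in
     (p powr (1 / p) * q powr (1 / q)) powr (- real n) * pi powr (- (real n / 2)) *
     (Gamma (real n / 2 + 1) / Gamma (real n / q + 1)))"

definition gamma_const :: "nat \<Rightarrow> real \<Rightarrow> real" where
  "gamma_const n p = (let q = conj_exponent p in
     real n * (q * exp 1) powr (p - 1) * pi powr (p / 2) *
     (Gamma (real n / 2 + 1) / Gamma (real n / q + 1)) powr (- (p / real n)))"

definition G_tilde :: "real \<Rightarrow> real^'n::finite \<Rightarrow> real" where
  "G_tilde p x = (let q = conj_exponent p in
     (C_const p CARD('n) * exp (- ((p - 1) / p powr q) * norm x powr q)) powr (1 / (p - 1)))"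

end

theory Submission
  imports Defs "HOL-Real_Asymp.Real_Asymp"
begin

text \<open>
  Put \<open>f = u powr (p - 1)\<close>, a probability density with \<open>I\<^sub>p(u) = \<integral> |\<nabla>f|^p / f^(p-1)\<close>. For every weight \<open>E\<close>,
  the entropy of \<open>f\<close> satisfies the dual bound
  \<open>n + ln (\<integral> E) \<le> \<integral> sup\<^sub>y (- y \<bullet> \<nabla>f + f ln E(y) - f ln f)\<close>.
  In dimension one it follows by transporting \<open>f\<close> monotonically onto \<open>E\<close> and using \<open>ln T' \<le> T' - 1\<close> and an
  integration by parts. It tensorises: applied to the slices \<open>f(\<cdot>, t)\<close> and \<open>E(\<cdot>, s)\<close> it yields, for all \<open>s\<close>
  and \<open>t\<close>, exactly the one-dimensional hypothesis for the two marginals. For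
  \<open>E(y) = exp (- |y|^q / (q s^q))\<close> Young's inequality bounds the supremum by \<open>s^p/p |\<nabla>f|^p / f^(p-1) - f ln f\<close>,
  and optimising over \<open>s\<close> gives the theorem.
\<close>

subsection \<open>The dual entropy bound on the line\<close>

text \<open>In dimension above one the weight \<open>exp (- k * norm y powr q)\<close> is not a
  product of functions of one coordinate unless q = 2, so one-dimensional bounds cannot simply be
  multiplied together. The dual form avoids this. Its hypothesis is affine in the slope of the
  density, so freezing one coordinate of y at s leaves a bound of the same form with another weight
  in the other coordinates. If the weight is a function of the squared norm, this only shifts its
  argument by the square of s. Integrating out the other coordinates leaves a one-dimensional weight
  in s whose total mass is that of the full weight, by Fubini. Two technical points shape the
  statements. First, y is confined to a cube, so the transport map is bounded and its product with
  an integrable slope is integrable; the cube grows to the whole space at the end. Second, a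
  marginal of the density is related to its slope only by integration over intervals. The lemmas on
  the line therefore assume the fundamental theorem of calculus in integrated form, and nothing is
  ever differentiated under an integral sign.\<close>

lemma tendsto_at_top_integrable_imp_zero:
  fixes m :: "real \<Rightarrow> real"
  assumes m: "integrable lborel m" and lim: "(m \<longlongrightarrow> L) at_top"
  shows "L = 0"
proof (rule ccontr)
  assume "L \<noteq> 0"
  then have "\<bar>L\<bar> / 2 > 0" by simp
  have "((\<lambda>x. \<bar>m x\<bar>) \<longlongrightarrow> \<bar>L\<bar>) at_top" using lim by (rule tendsto_rabs)
  then have "eventually (\<lambda>x. \<bar>m x\<bar> > \<bar>L\<bar> / 2) at_top"
    using \<open>L \<noteq> 0\<close> by (intro order_tendstoD(1)) auto
  then obtain b where b: "\<And>x. x \<ge> b \<Longrightarrow> \<bar>m x\<bar> > \<bar>L\<bar> / 2"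
    unfolding eventually_at_top_linorder by blast
  have "emeasure lborel {b..} = \<infinity>"
  proof (rule ccontr)
    assume "emeasure lborel {b..} \<noteq> \<infinity>"
    then obtain r where r: "r \<ge> 0" "emeasure lborel {b..} = ennreal r"
      by (metis ennreal_cases infinity_ennreal_def)
    have "emeasure lborel {b..b + r + 1} \<le> emeasure lborel {b..}"
      by (intro emeasure_mono) auto
    with r show False by (simp add: ennreal_le_iff2)
  qed
  moreover have "ennreal (\<bar>L\<bar>/2) * emeasure lborel {b..} \<le> (\<integral>\<^sup>+x. ennreal (norm (m x)) \<partial>lborel)"
  proof -
    have "ennreal (\<bar>L\<bar>/2) * emeasure lborel {b..} = (\<integral>\<^sup>+x. ennreal (\<bar>L\<bar>/2) * indicator {b..} x \<partial>lborel)"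
      by (subst nn_integral_cmult_indicator) auto
    also have "\<dots> \<le> (\<integral>\<^sup>+x. ennreal (norm (m x)) \<partial>lborel)"
      using b by (intro nn_integral_mono) (auto simp: indicator_def less_imp_le intro!: ennreal_leI)
    finally show ?thesis .
  qed
  moreover have "(\<integral>\<^sup>+x. ennreal (norm (m x)) \<partial>lborel) < \<infinity>"
    using m by (simp add: integrable_iff_bounded)
  ultimately show False using \<open>\<bar>L\<bar>/2 > 0\<close> by (simp add: ennreal_mult_top del: half_gt_zero_iff)
qed

text \<open>Integrability of \<open>dm\<close> gives \<open>m\<close> a limit at both ends, and
  integrability of \<open>m\<close> forces these limits to be zero. Decay of \<open>m\<close> is
  thus derived, and boundary terms vanish in the integration by parts.\<close>

lemma
  fixes m dm :: "real \<Rightarrow> real"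
  assumes m: "integrable lborel m" and dm: "integrable lborel dm"
    and ftc: "\<And>a b. a \<le> b \<Longrightarrow> m b - m a = (\<integral>t. indicator {a..b} t * dm t \<partial>lborel)"
  shows integral_atMost_of_FTC: "(\<integral>r. indicator {..t} r * dm r \<partial>lborel) = m t"
    and integral_of_FTC: "(\<integral>r. dm r \<partial>lborel) = 0"
proof -
  have lower: "((\<lambda>a. \<integral>r. indicator {-a..t} r * dm r \<partial>lborel) \<longlongrightarrow> (\<integral>r. indicator {..t} r * dm r \<partial>lborel)) at_top" for t
  proof (rule integral_dominated_convergence_at_top)
    show "integrable lborel (\<lambda>r. norm (dm r))" using dm by simp
    show "AE x in lborel. ((\<lambda>a. indicat_real {- a..t} x * dm x) \<longlongrightarrow> indicat_real {..t} x * dm x) at_top"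
    proof (rule AE_I2)
      fix x
      have "eventually (\<lambda>a. indicat_real {- a..t} x * dm x = indicat_real {..t} x * dm x) at_top"
        using eventually_ge_at_top[of "-x"] by eventually_elim (auto simp: indicator_def)
      then show "((\<lambda>a. indicat_real {- a..t} x * dm x) \<longlongrightarrow> indicat_real {..t} x * dm x) at_top"
        by (rule tendsto_eventually)
    qed
    show "\<forall>\<^sub>F i in at_top. AE x in lborel. norm (indicat_real {- i..t} x * dm x) \<le> norm (dm x)"
      by (auto simp: indicator_def)
  qed (use dm in auto)
  have "((\<lambda>a. m t - m (-a)) \<longlongrightarrow> (\<integral>r. indicator {..t} r * dm r \<partial>lborel)) at_top" for t
  proof (rule Lim_transform_eventually[OF lower])
    show "\<forall>\<^sub>F x in at_top. (\<integral>r. indicat_real {- x..t} r * dm r \<partial>lborel) = m t - m (- x)"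
      using eventually_ge_at_top[of "-t"] by eventually_elim (simp add: ftc)
  qed
  from tendsto_diff[OF tendsto_const this]
  have "((\<lambda>a. m t - (m t - m (-a))) \<longlongrightarrow> m t - (\<integral>r. indicator {..t} r * dm r \<partial>lborel)) at_top" for t .
  then have L: "((\<lambda>a. m (-a)) \<longlongrightarrow> m t - (\<integral>r. indicator {..t} r * dm r \<partial>lborel)) at_top" for t by simp
  have "integrable lborel (\<lambda>a. m (-a))"
    using lborel_integrable_real_affine[OF m, of "-1" 0] by simp
  from tendsto_at_top_integrable_imp_zero[OF this L]
  show eq: "(\<integral>r. indicator {..t} r * dm r \<partial>lborel) = m t" for t by simp
  have "((\<lambda>t. \<integral>r. indicator {..t} r *\<^sub>R dm r \<partial>lborel) \<longlongrightarrow> (\<integral>r. dm r \<partial>lborel)) at_top"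
    by (rule tendsto_integral_at_top) (use dm in auto)
  then have "(m \<longlongrightarrow> (\<integral>r. dm r \<partial>lborel)) at_top" by (simp add: eq)
  from tendsto_at_top_integrable_imp_zero[OF m this] show "(\<integral>r. dm r \<partial>lborel) = 0" .
qed

text \<open>An indefinite integral of an integrable function is continuous. For the marginals of the
  density this replaces a domination argument.\<close>

lemma continuous_of_FTC:
  fixes m dm :: "real \<Rightarrow> real"
  assumes dm: "integrable lborel dm"
    and ftc: "\<And>a b. a \<le> b \<Longrightarrow> m b - m a = (\<integral>t. indicator {a..b} t * dm t \<partial>lborel)"
  shows "continuous_on UNIV m"
proof -
  have "isCont m x" for x
  proof -
    have si: "set_integrable lborel {a..b} dm" for a b
      unfolding set_integrable_def using integrable_mult_indicator[OF _ dm, of "{a..b}"] by simp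
    have eq: "m t = m (x - 1) + integral {x-1..t} dm" if "t \<ge> x - 1" for t
      using ftc[OF that] set_borel_integral_eq_integral(2)[OF si, of "x-1" t]
      by (simp add: set_lebesgue_integral_def)
    have "continuous_on {x-1..x+1} (\<lambda>t. m (x-1) + integral {x-1..t} dm)"
      by (rule continuous_on_add[OF continuous_on_const
            indefinite_integral_continuous_1[OF set_borel_integral_eq_integral(1)[OF si]]])
    then have "continuous_on {x-1..x+1} m"
      by (rule continuous_on_eq) (rule eq[symmetric], simp)
    then show ?thesis by (rule continuous_on_interior) auto
  qed
  then show ?thesis by (simp add: continuous_on_eq_continuous_at)
qed

lemma DERIV_integral_atMost:
  fixes m :: "real \<Rightarrow> real"
  assumes m: "integrable lborel m" and cont: "continuous_on UNIV m"
  shows "((\<lambda>t. \<integral>r. indicator {..t} r * m r \<partial>lborel) has_real_derivative m x) (at x)"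
proof -
  let ?F = "\<lambda>t. \<integral>r. indicator {..t} r * m r \<partial>lborel"
  have bdd: "integrable lborel (\<lambda>r. indicator A r * m r)" if "A \<in> sets borel" for A
    using integrable_mult_indicator[OF _ m, of A] that by simp
  have si: "set_integrable lborel {a..b} m" for a b
    unfolding set_integrable_def using bdd by simp
  have eq: "?F t = ?F (x - 1) + integral {x-1..t} m" if "t \<ge> x - 1" for t
  proof -
    have "?F t = (\<integral>r. indicator {..x-1} r * m r + indicator {x-1..t} r * m r \<partial>lborel)"
    proof (rule integral_cong_AE)
      have "AE r in lborel. r \<noteq> x - 1" by (rule AE_lborel_singleton)
      then show "AE r in lborel. indicat_real {..t} r * m r = indicat_real {..x - 1} r * m r + indicat_real {x - 1..t} r * m r"
        by eventually_elim (use that in \<open>auto simp: indicator_def\<close>)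
    qed (use m in auto)
    also have "\<dots> = ?F (x-1) + (\<integral>r. indicator {x-1..t} r * m r \<partial>lborel)"
      by (intro Bochner_Integration.integral_add bdd) auto
    finally show ?thesis
      using set_borel_integral_eq_integral(2)[OF si, of "x-1" t] by (simp add: set_lebesgue_integral_def)
  qed
  have c: "continuous_on {x-1..x+1} m" using cont by (rule continuous_on_subset) auto
  have "((\<lambda>t. ?F (x-1) + integral {x-1..t} m) has_real_derivative m x) (at x within {x-1..x+1})"
    using integral_has_real_derivative[OF c, of x] by (auto intro!: derivative_eq_intros)
  then have "((\<lambda>t. ?F (x-1) + integral {x-1..t} m) has_real_derivative m x) (at x)"
    by (simp add: at_within_Icc_at)
  then show ?thesis
  proof (rule has_field_derivative_transform_within_open[where S = "{x-1<..<x+1}"])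
    fix y assume "y \<in> {x-1<..<x+1}" then show "?F (x-1) + integral {x-1..y} m = ?F y"
      using eq[of y] by simp
  qed auto
qed

text \<open>With \<open>F\<close> and \<open>G\<close> the distribution functions of
  \<open>m\<close> and of \<open>E\<close> on the interval, \<open>T\<close> solves
  \<open>G (T t) = Z / M * F t\<close>, and differentiating this gives the stated slope. The bounded
  range makes \<open>dm t * T t\<close> integrable later, and the limit \<open>R\<close> evaluates
  the integral of the slope over a half-line.\<close>

lemma ex_transport:
  fixes m E :: "real \<Rightarrow> real"
  assumes m: "integrable lborel m" and mpos: "\<And>t. m t > 0" and mcont: "continuous_on UNIV m"
    and R: "R > 0" and E: "continuous_on UNIV E" and Epos: "\<And>s. E s > 0"
    and Z: "Z = integral {-R..R} E" and M: "M = (\<integral>t. m t \<partial>lborel)"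
  obtains T where "\<And>t. T t \<in> {-R..R}" "continuous_on UNIV T" "(T \<longlongrightarrow> R) at_top"
    "\<And>t. (T has_real_derivative (Z / M * m t / E (T t))) (at t)" "M > 0" "Z > 0"
proof -
  define F where "F = (\<lambda>t. \<integral>r. indicator {..t} r * m r \<partial>lborel)"
  have dF: "(F has_real_derivative m t) (at t)" for t
    unfolding F_def by (rule DERIV_integral_atMost[OF m mcont])
  have Fless: "F a < F b" if "a < b" for a b
    using that by (rule DERIV_pos_imp_increasing) (use dF mpos in blast)
  have F0: "F t \<ge> 0" for t unfolding F_def using mpos by (intro integral_nonneg_AE) (auto simp: less_imp_le)
  have bdd: "integrable lborel (\<lambda>r. indicator A r * m r)" if "A \<in> sets borel" for A
    using integrable_mult_indicator[OF _ m, of A] that by simp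
  have FM: "F t \<le> M" for t unfolding F_def M
    using mpos by (intro integral_mono bdd m) (auto simp: indicator_def less_imp_le)
  have Fp: "F t > 0" for t using Fless[of "t-1" t] F0[of "t-1"] by simp
  have Fl: "F t < M" for t using Fless[of t "t+1"] FM[of "t+1"] by simp
  have Mpos: "M > 0" using Fp[of 0] Fl[of 0] by simp
  have Flim: "(F \<longlongrightarrow> M) at_top"
    using tendsto_integral_at_top[OF _ m] by (simp add: F_def M)
  define G where "G = (\<lambda>s. integral {-R..s} E)"
  have dG: "(G has_real_derivative E s) (at s within {-R..R})" if "s \<in> {-R..R}" for s
    unfolding G_def using that by (intro integral_has_real_derivative continuous_on_subset[OF E]) auto
  have Gcont: "continuous_on {-R..R} G"
    using dG by (meson DERIV_continuous_on)
  have Gless: "G a < G b" if "a < b" "a \<in> {-R..R}" "b \<in> {-R..R}" for a b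
  proof (rule DERIV_pos_imp_increasing_open[OF \<open>a < b\<close>])
    fix x assume "a < x" "x < b"
    then show "\<exists>y. (G has_real_derivative y) (at x) \<and> 0 < y"
      using dG[of x] that Epos[of x] by (auto simp: at_within_Icc_at)
  next
    show "continuous_on {a..b} G" using Gcont by (rule continuous_on_subset) (use that in auto)
  qed
  have G0: "G (-R) = 0" "G R = Z" by (simp_all add: G_def Z)
  have Zpos: "Z > 0" using Gless[of "-R" R] R G0 by simp
  have inj: "inj_on G {-R..R}"
    by (intro linorder_inj_onI') (use Gless in force)
  have img: "G ` {-R..R} = {0..Z}"
  proof
    show "G ` {-R..R} \<subseteq> {0..Z}"
    proof clarify
      fix s assume "s \<in> {-R..R}"
      then show "G s \<in> {0..Z}" using Gless[of "-R" s] Gless[of s R] G0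
        by (cases "s = -R"; cases "s = R") (auto simp: less_imp_le)
    qed
    show "{0..Z} \<subseteq> G ` {-R..R}"
    proof
      fix v assume "v \<in> {0..Z}"
      then show "v \<in> G ` {-R..R}" using IVT'[of G "-R" v R] Gcont G0 R by auto
    qed
  qed
  define g where "g = the_inv_into {-R..R} G"
  have gG: "g (G s) = s" if "s \<in> {-R..R}" for s
    unfolding g_def by (rule the_inv_into_f_f[OF inj that])
  have Gg: "G (g v) = v" if "v \<in> {0..Z}" for v
    unfolding g_def using f_the_inv_into_f[OF inj, of v] that img by simp
  have gin: "g v \<in> {-R..R}" if "v \<in> {0..Z}" for v
    unfolding g_def using the_inv_into_into[OF inj, of v "{-R..R}"] that img by simp
  have gcont: "continuous_on {0..Z} g"
    using continuous_on_inv[OF Gcont, of g] gG img by simp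
  have dg: "(g has_real_derivative inverse (E (g v))) (at v)" if v: "v \<in> {0<..<Z}" for v
  proof -
    have v': "v \<in> {0..Z}" using v by auto
    have "g v \<noteq> -R" "g v \<noteq> R" using Gg[OF v'] G0 v by auto
    then have gv: "g v \<in> {-R<..<R}" using gin[OF v'] by auto
    show ?thesis
    proof (rule DERIV_inverse_function[where f = G and a = 0 and b = Z])
      show "(G has_real_derivative E (g v)) (at (g v))"
        using dG[of "g v"] gv by (auto simp: at_within_Icc_at)
      show "E (g v) \<noteq> 0" using Epos[of "g v"] by simp
      show "isCont g v" using gcont v by (intro continuous_on_interior[OF gcont]) auto
    qed (use v Gg in auto)
  qed
  define T where "T = (\<lambda>t. g (Z / M * F t))"
  \<comment> \<open>Strictness comes from the positivity of \<open>m\<close> on both sides of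
    \<open>t\<close>. Hence \<open>g\<close> is differentiated at interior points only, where
    \<open>G\<close> has a two-sided derivative.\<close>
  have rng: "Z / M * F t \<in> {0<..<Z}" for t
    using Fp[of t] Fl[of t] Mpos Zpos by (auto simp: field_simps)
  have dT: "(T has_real_derivative (Z / M * m t / E (T t))) (at t)" for t
  proof -
    have "((\<lambda>t. Z / M * F t) has_real_derivative Z / M * m t) (at t)"
      by (intro DERIV_cmult dF)
    from DERIV_chain2[OF dg[OF rng] this] show ?thesis
      unfolding T_def by (simp add: field_simps)
  qed
  show ?thesis
  proof (rule that[of T])
    show "T t \<in> {-R..R}" for t unfolding T_def by (rule gin) (use rng[of t] in auto)
    show "continuous_on UNIV T"
      using dT by (meson DERIV_isCont continuous_at_imp_continuous_on)
    show "(T \<longlongrightarrow> R) at_top"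
    proof -
      have "((\<lambda>t. Z / M * F t) \<longlongrightarrow> Z / M * M) at_top" by (intro tendsto_intros Flim)
      then have "((\<lambda>t. Z / M * F t) \<longlongrightarrow> Z) at_top" using Mpos by simp
      from continuous_on_tendsto_compose[OF gcont this]
      have "(T \<longlongrightarrow> g Z) at_top" unfolding T_def using Zpos rng
        by (simp add: less_imp_le)
      moreover have "g Z = R" using gG[of R] R G0 by simp
      ultimately show ?thesis by simp
    qed
    show "(T has_real_derivative (Z / M * m t / E (T t))) (at t)" for t by (rule dT)
  qed (fact Mpos Zpos)+
qed

text \<open>Fubini for \<open>dm r * T' t\<close> on the half-plane where t is at least r.
  Integrating over t first gives \<open>dm r * (R - T r)\<close>, integrating over r first gives
  \<open>m t * T' t\<close>. Integrability of the latter is a by-product of the bound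
  \<open>2 * R * \<bar>dm r\<bar>\<close> on the former.\<close>

lemma ibp_of_FTC:
  fixes m dm T T' :: "real \<Rightarrow> real"
  assumes m: "integrable lborel m" and dm: "integrable lborel dm"
    and ftc: "\<And>a b. a \<le> b \<Longrightarrow> m b - m a = (\<integral>t. indicator {a..b} t * dm t \<partial>lborel)"
    and Tr: "\<And>t. T t \<in> {-R..R}" and Tlim: "(T \<longlongrightarrow> R) at_top"
    and dT: "\<And>t. (T has_real_derivative T' t) (at t)" and T'0: "\<And>t. T' t \<ge> 0"
    and T'm[measurable]: "T' \<in> borel_measurable borel" and Tm[measurable]: "T \<in> borel_measurable borel"
  shows "integrable lborel (\<lambda>t. m t * T' t)" "integrable lborel (\<lambda>t. dm t * T t)"
    "(\<integral>t. m t * T' t \<partial>lborel) = - (\<integral>t. dm t * T t \<partial>lborel)"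
proof -
  interpret lborel_pair: pair_sigma_finite "lborel :: real measure" "lborel :: real measure" ..
  note [measurable] = borel_measurable_integrable[OF dm] borel_measurable_integrable[OF m]
  define f where "f = (\<lambda>(r, t). indicator {r..} t * (dm r * T' t))"
  have f_eq: "f = (\<lambda>p. if fst p \<le> snd p then dm (fst p) * T' (snd p) else 0)"
    by (auto simp: f_def indicator_def fun_eq_iff)
  have fm[measurable]: "f \<in> borel_measurable (lborel \<Otimes>\<^sub>M lborel)"
    unfolding f_eq by measurable
  have nn: "(\<integral>\<^sup>+t. ennreal (T' t) * indicator {r..} t \<partial>lborel) = ennreal (R - T r)" for r
    by (rule nn_integral_FTC_atLeast) (use dT T'0 Tlim in auto)
  have hb: "has_bochner_integral lborel (\<lambda>t. indicator {r..} t * T' t) (R - T r)" for r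
  proof (rule has_bochner_integral_nn_integral)
    show "(\<integral>\<^sup>+ x. ennreal (indicat_real {r..} x * T' x) \<partial>lborel) = ennreal (R - T r)"
      unfolding nn[symmetric] by (intro nn_integral_cong) (auto simp: indicator_def)
  qed (use T'0 Tr[of r] in auto)
  have hbf: "has_bochner_integral lborel (\<lambda>t. f (r, t)) (dm r * (R - T r))" for r
    using has_bochner_integral_mult_right[OF hb, of "dm r" r] by (simp add: f_def ac_simps)
  have hbn: "has_bochner_integral lborel (\<lambda>t. norm (f (r, t))) (\<bar>dm r\<bar> * (R - T r))" for r
  proof -
    have "norm (f (r,t)) = \<bar>dm r\<bar> * (indicator {r..} t * T' t)" for t
      using T'0[of t] by (simp add: f_def abs_mult)
    then show ?thesis using has_bochner_integral_mult_right[OF hb, of "\<bar>dm r\<bar>" r] by simp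
  qed
  have int: "integrable lborel (\<lambda>r. \<bar>dm r\<bar> * (R - T r))"
  proof (rule Bochner_Integration.integrable_bound)
    show "integrable lborel (\<lambda>r. 2 * R * \<bar>dm r\<bar>)" using dm by simp
    show "AE x in lborel. norm (\<bar>dm x\<bar> * (R - T x)) \<le> norm (2 * R * \<bar>dm x\<bar>)"
    proof (rule AE_I2)
      fix x show "norm (\<bar>dm x\<bar> * (R - T x)) \<le> norm (2 * R * \<bar>dm x\<bar>)"
        using Tr[of x] by (simp add: abs_mult mult.commute[of _ "\<bar>dm x\<bar>"] mult_left_mono)
    qed
  qed auto
  have fint: "integrable (lborel \<Otimes>\<^sub>M lborel) f"
  proof (rule lborel_pair.Fubini_integrable)
    show "integrable lborel (\<lambda>x. \<integral>y. norm (f (x, y)) \<partial>lborel)"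
      using int has_bochner_integral_integral_eq[OF hbn] by simp
    show "AE x in lborel. integrable lborel (\<lambda>y. f (x, y))"
      using hbf by (auto simp: has_bochner_integral_iff)
  qed auto
  have inner: "(\<integral>r. f (r, t) \<partial>lborel) = m t * T' t" for t
  proof -
    have "(\<integral>r. f (r, t) \<partial>lborel) = (\<integral>r. (indicator {..t} r * dm r) * T' t \<partial>lborel)"
      by (intro Bochner_Integration.integral_cong) (auto simp: f_def indicator_def)
    also have "\<dots> = m t * T' t"
      using integral_atMost_of_FTC[OF m dm ftc, of t] by simp
    finally show ?thesis .
  qed
  show i1: "integrable lborel (\<lambda>t. m t * T' t)"
    using lborel_pair.integrable_snd[of "\<lambda>r t. f (r, t)"] fint by (simp add: inner split_beta')
  have i3: "integrable lborel (\<lambda>r. dm r * (R - T r))"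
    by (rule Bochner_Integration.integrable_bound[OF int]) (auto simp: abs_mult)
  from Bochner_Integration.integrable_diff[OF integrable_mult_left[OF dm, of R] i3]
  show i2: "integrable lborel (\<lambda>t. dm t * T t)" by (simp add: algebra_simps)
  have "(\<integral>t. m t * T' t \<partial>lborel) = (\<integral>t. \<integral>r. f (r, t) \<partial>lborel \<partial>lborel)" by (simp add: inner)
  also have "\<dots> = (\<integral>r. \<integral>t. f (r, t) \<partial>lborel \<partial>lborel)"
    using lborel_pair.Fubini_integral[of "\<lambda>r t. f (r, t)"] fint by (simp add: split_beta')
  also have "\<dots> = (\<integral>r. dm r * R - dm r * T r \<partial>lborel)"
    by (simp add: has_bochner_integral_integral_eq[OF hbf] right_diff_distrib)
  \<comment> \<open>The constant \<open>R\<close> drops out because \<open>dm\<close> has integral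
    zero.\<close>
  also have "\<dots> = - (\<integral>t. dm t * T t \<partial>lborel)"
    using integral_of_FTC[OF m dm ftc] i2 dm by simp
  finally show "(\<integral>t. m t * T' t \<partial>lborel) = - (\<integral>t. dm t * T t \<partial>lborel)" .
qed

text \<open>Put \<open>s = T t\<close> in \<open>le\<close>: the transport equation turns
  \<open>m t * ln (E (T t)) - m t * ln (m t)\<close> into
  \<open>m t * ln (Z / M) - m t * ln (T' t)\<close>. The mass \<open>M\<close> is left free because
  slices of a probability density are not normalised, and \<open>le\<close> is asked almost
  everywhere because slices are well behaved only for almost every t.\<close>

lemma dual_entropy_bound_real:
  fixes m dm \<Psi> E :: "real \<Rightarrow> real"
  assumes m: "integrable lborel m" and mpos: "\<And>t. m t > 0" and dm: "integrable lborel dm"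
    and ftc: "\<And>a b. a \<le> b \<Longrightarrow> m b - m a = (\<integral>t. indicator {a..b} t * dm t \<partial>lborel)"
    and R: "R > 0" and E: "continuous_on UNIV E" and Epos: "\<And>s. E s > 0"
    and \<Psi>: "integrable lborel \<Psi>"
    and le: "AE t in lborel. \<forall>s\<in>{-R..R}. \<Psi> t \<ge> - s * dm t + m t * ln (E s) - m t * ln (m t)"
    and Z: "Z = integral {-R..R} E" and M: "M = (\<integral>t. m t \<partial>lborel)"
  shows "(\<integral>t. \<Psi> t \<partial>lborel) \<ge> M * (1 + ln Z) - M * ln M"
proof -
  have mcont: "continuous_on UNIV m" by (rule continuous_of_FTC[OF dm ftc])
  obtain T where Tr: "\<And>t. T t \<in> {-R..R}" and Tcont: "continuous_on UNIV T"
    and Tlim: "(T \<longlongrightarrow> R) at_top"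
    and dT: "\<And>t. (T has_real_derivative (Z / M * m t / E (T t))) (at t)" and Mpos: "M > 0" and Zpos: "Z > 0"
    by (rule ex_transport[OF m mpos mcont R E Epos Z M]) blast
  define T' where "T' = (\<lambda>t. Z / M * m t / E (T t))"
  have T'pos: "T' t > 0" for t unfolding T'_def using Mpos Zpos mpos[of t] Epos[of "T t"] by simp
  have ET: "continuous_on UNIV (\<lambda>t. E (T t))"
    using continuous_on_compose2[OF E Tcont] by simp
  have "continuous_on UNIV T'" unfolding T'_def
    using Epos Mpos by (intro continuous_intros mcont ET) (auto simp: less_imp_neq[symmetric])
  then have T'm: "T' \<in> borel_measurable borel" by (rule borel_measurable_continuous_onI)
  have dT': "(T has_real_derivative T' t) (at t)" for t unfolding T'_def by (rule dT)
  note ibp = ibp_of_FTC[OF m dm ftc Tr Tlim dT' less_imp_le[OF T'pos] T'm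
      borel_measurable_continuous_onI[OF Tcont]]
  \<comment> \<open>The two subtracted integrals cancel by \<open>ibp(3)\<close>. They are inserted
    so that the comparison with \<open>\<Psi>\<close> can be made pointwise.\<close>
  have "M * (1 + ln Z) - M * ln M = M * (1 + ln (Z / M)) - (\<integral>t. m t * T' t \<partial>lborel) - (\<integral>t. dm t * T t \<partial>lborel)"
    using ibp(3) Mpos Zpos by (simp add: ln_div algebra_simps)
  also have "\<dots> = (\<integral>t. m t * (1 + ln (Z / M)) - m t * T' t - dm t * T t \<partial>lborel)"
    using ibp m by (simp add: M)
  also have "\<dots> \<le> (\<integral>t. \<Psi> t \<partial>lborel)"
  proof (rule integral_mono_AE)
    from le show "AE t in lborel. m t * (1 + ln (Z / M)) - m t * T' t - dm t * T t \<le> \<Psi> t"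
    proof eventually_elim
      case (elim t)
      have "ln (T' t) = ln (Z / M) + ln (m t) - ln (E (T t))"
        unfolding T'_def using Mpos Zpos mpos[of t] Epos[of "T t"] by (simp add: ln_div ln_mult)
      moreover have "ln (T' t) \<le> T' t - 1" by (rule ln_le_minus_one[OF T'pos])
      ultimately have "1 + ln (Z/M) - T' t \<le> ln (E (T t)) - ln (m t)" by simp
      from mult_left_mono[OF this less_imp_le[OF mpos[of t]]]
      have "m t * (1 + ln (Z / M)) - m t * T' t \<le> m t * ln (E (T t)) - m t * ln (m t)"
        by (simp add: algebra_simps)
      with elim Tr[of t] show ?case by (fastforce simp: algebra_simps)
    qed
  qed (use ibp m \<Psi> in auto)
  finally show ?thesis .
qed

subsection \<open>Tensorisation\<close>

lemma integrable_eqI: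
  assumes "integrable M f" and "\<And>x. x \<in> space M \<Longrightarrow> f x = g x"
  shows "integrable M g"
  using assms Bochner_Integration.integrable_cong[of M M f g] by blast

context product_sigma_finite
begin

text \<open>Boxes determine a finite product measure, and the preimage of a box is its factor at
  \<open>i\<close> times the box of the remaining factors.\<close>

lemma distr_fun_upd_PiM:
  assumes I: "finite I" "i \<notin> I"
  shows "distr (M i \<Otimes>\<^sub>M PiM I M) (PiM (insert i I) M) (\<lambda>(t, x). x(i := t)) = PiM (insert i I) M"
proof (rule PiM_eqI)
  interpret sigma_finite_measure "PiM I M" by (rule sigma_finite[OF I(1)])
  fix A assume A: "\<And>j. j \<in> insert i I \<Longrightarrow> A j \<in> sets (M j)"
  have meas: "(\<lambda>(t, x). x(i := t)) \<in> measurable (M i \<Otimes>\<^sub>M PiM I M) (PiM (insert i I) M)"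
    unfolding split_beta' by (rule measurable_fun_upd[of _ I]) (use I in auto)
  have eq: "(\<lambda>(t, x). x(i := t)) -` Pi\<^sub>E (insert i I) A \<inter> space (M i \<Otimes>\<^sub>M PiM I M) = A i \<times> Pi\<^sub>E I A"
  proof (intro set_eqI iffI)
    fix p assume p: "p \<in> (\<lambda>(t, x). x(i := t)) -` Pi\<^sub>E (insert i I) A \<inter> space (M i \<Otimes>\<^sub>M PiM I M)"
    obtain t x where tx: "p = (t, x)" by (cases p)
    with p have x: "x(i := t) \<in> Pi\<^sub>E (insert i I) A" "x \<in> extensional I"
      by (auto simp: space_pair_measure space_PiM PiE_def)
    have "x j \<in> A j" if "j \<in> I" for j
      using PiE_mem[OF x(1), of j] that I(2) by (cases "j = i") auto
    with x(2) PiE_mem[OF x(1), of i] show "p \<in> A i \<times> Pi\<^sub>E I A" by (auto simp: tx PiE_def)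
  next
    fix p assume p: "p \<in> A i \<times> Pi\<^sub>E I A"
    then show "p \<in> (\<lambda>(t, x). x(i := t)) -` Pi\<^sub>E (insert i I) A \<inter> space (M i \<Otimes>\<^sub>M PiM I M)"
      using A[THEN sets.sets_into_space] I(2)
      by (auto simp: space_pair_measure space_PiM PiE_def extensional_def Pi_iff subset_eq)
  qed
  have "emeasure (distr (M i \<Otimes>\<^sub>M PiM I M) (PiM (insert i I) M) (\<lambda>(t, x). x(i := t))) (Pi\<^sub>E (insert i I) A)
      = emeasure (M i \<Otimes>\<^sub>M PiM I M) (A i \<times> Pi\<^sub>E I A)"
    using A I by (subst emeasure_distr[OF meas]) (auto simp: eq intro!: sets_PiM_I_finite)
  also have "\<dots> = (\<Prod>j\<in>insert i I. emeasure (M j) (A j))"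
    using A I by (subst emeasure_pair_measure_Times) (auto intro!: sets_PiM_I_finite simp: emeasure_PiM)
  finally show "emeasure (distr (M i \<Otimes>\<^sub>M PiM I M) (PiM (insert i I) M) (\<lambda>(t, x). x(i := t))) (Pi\<^sub>E (insert i I) A)
      = (\<Prod>j\<in>insert i I. emeasure (M j) (A j))" .
qed (use I in auto)

lemma measurable_fun_upd_PiM:
  assumes "i \<notin> I"
  shows "(\<lambda>(t, x). x(i := t)) \<in> measurable (M i \<Otimes>\<^sub>M PiM I M) (PiM (insert i I) M)"
  unfolding split_beta' by (rule measurable_fun_upd[of _ I]) (use assms in auto)

text \<open>Fubini with the new coordinate as the outer variable, so that for fixed t the inner
  integral is one over the smaller index set, where the induction hypothesis speaks.\<close>

lemma
  fixes g :: "_ \<Rightarrow> real"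
  assumes I: "finite I" "i \<notin> I" and g: "integrable (PiM (insert i I) M) g"
  shows integrable_fun_upd_PiM: "integrable (M i \<Otimes>\<^sub>M PiM I M) (\<lambda>(t, x). g (x(i := t)))"
    and integral_fun_upd_PiM:
      "integral\<^sup>L (PiM (insert i I) M) g = (\<integral>t. \<integral>x. g (x(i := t)) \<partial>PiM I M \<partial>M i)"
proof -
  interpret P: sigma_finite_measure "PiM I M" by (rule sigma_finite[OF I(1)])
  interpret pair_sigma_finite "M i" "PiM I M" ..
  have g': "integrable (distr (M i \<Otimes>\<^sub>M PiM I M) (PiM (insert i I) M) (\<lambda>(t, x). x(i := t))) g"
    by (simp add: distr_fun_upd_PiM[OF I] g)
  show int: "integrable (M i \<Otimes>\<^sub>M PiM I M) (\<lambda>(t, x). g (x(i := t)))"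
    using integrable_distr[OF measurable_fun_upd_PiM[OF I(2)] g'] by (simp add: split_beta')
  have "integral\<^sup>L (PiM (insert i I) M) g
      = integral\<^sup>L (distr (M i \<Otimes>\<^sub>M PiM I M) (PiM (insert i I) M) (\<lambda>(t, x). x(i := t))) g"
    by (simp add: distr_fun_upd_PiM[OF I])
  also have "\<dots> = integral\<^sup>L (M i \<Otimes>\<^sub>M PiM I M) (\<lambda>(t, x). g (x(i := t)))"
    by (subst integral_distr[OF measurable_fun_upd_PiM[OF I(2)]]) (use g in \<open>auto simp: split_beta'\<close>)
  also have "\<dots> = (\<integral>t. \<integral>x. g (x(i := t)) \<partial>PiM I M \<partial>M i)"
    using integral_fst'[OF int] by simp
  finally show "integral\<^sup>L (PiM (insert i I) M) g = (\<integral>t. \<integral>x. g (x(i := t)) \<partial>PiM I M \<partial>M i)" .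
qed

end

section \<open>Lebesgue measure on finite products and radial weights on cubes\<close>

interpretation lborel_PiM: product_sigma_finite "\<lambda>_::'i. lborel :: real measure"
  by standard

abbreviation PiL :: "'i set \<Rightarrow> ('i \<Rightarrow> real) measure" where
  "PiL I \<equiv> PiM I (\<lambda>_. lborel)"

text \<open>A nonnegative integrand with integral zero vanishes almost everywhere, which is
  impossible on a cube of positive measure. Positivity is asked on the cube only, so that integrands
  cut off outside it are covered too.\<close>

lemma integral_PiL_pos:
  fixes f :: "('i \<Rightarrow> real) \<Rightarrow> real"
  assumes I: "finite I" and f: "integrable (PiL I) f"
    and nn: "\<And>x. f x \<ge> 0" and pos: "\<And>x. (\<And>i. i \<in> I \<Longrightarrow> \<bar>x i\<bar> \<le> R) \<Longrightarrow> f x > 0" and R: "R > 0"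
  shows "(\<integral>x. f x \<partial>PiL I) > 0"
proof (rule ccontr)
  let ?C = "\<Pi>\<^sub>E i\<in>I. {-R..R}"
  assume "\<not> ?thesis"
  moreover have "(\<integral>x. f x \<partial>PiL I) \<ge> 0" using nn by (intro integral_nonneg_AE) auto
  ultimately have "(\<integral>x. f x \<partial>PiL I) = 0" by simp
  then have "AE x in PiL I. f x = 0"
    using integral_nonneg_eq_0_iff_AE[OF f] nn by simp
  then have "AE x in PiL I. x \<notin> ?C"
  proof eventually_elim
    case (elim x)
    show ?case
    proof
      assume "x \<in> ?C"
      then have "\<bar>x i\<bar> \<le> R" if "i \<in> I" for i using PiE_mem[of x I "\<lambda>_. {-R..R}" i] that by auto
      then have "f x > 0" by (rule pos)
      with elim show False by simp
    qed
  qed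
  moreover have C: "?C \<in> sets (PiL I)" using I by (intro sets_PiM_I_finite) auto
  ultimately have "emeasure (PiL I) ?C = 0"
    using AE_iff_null_sets[OF C] by (auto dest: null_setsD1)
  moreover have "emeasure (PiL I) ?C = (\<Prod>i\<in>I. ennreal (2 * R))"
    using I R by (subst lborel_PiM.emeasure_PiM) auto
  ultimately show False using R I by (simp add: ennreal_zero_less_mult_iff prod_ennreal)
qed

text \<open>The weight is given by its profile \<open>h\<close> in the squared norm. Freezing a
  coordinate at s replaces \<open>c\<close> by \<open>c + s\<^sup>2\<close>, so all slices of a
  weight stay in this one family.\<close>

definition cube_integral :: "(real \<Rightarrow> real) \<Rightarrow> real \<Rightarrow> 'i set \<Rightarrow> real \<Rightarrow> real" where
  "cube_integral h R I c =
     (\<integral>y. indicator (\<Pi>\<^sub>E i\<in>I. {-R..R}) y * h (c + (\<Sum>i\<in>I. (y i)\<^sup>2)) \<partial>PiL I)"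

context
  fixes h :: "real \<Rightarrow> real" and R B :: real
  assumes R: "R > 0" and h: "continuous_on {0..} h" and hpos: "\<And>v. v \<ge> 0 \<Longrightarrow> h v > 0"
    and hB: "\<And>v. v \<ge> 0 \<Longrightarrow> h v \<le> B" and hm[measurable]: "h \<in> borel_measurable borel"
begin

lemma cube_integrand_integrable:
  assumes I: "finite I" and c: "c \<ge> 0"
  shows "integrable (PiL I) (\<lambda>y. indicator (\<Pi>\<^sub>E i\<in>I. {-R..R}) y * h (c + (\<Sum>i\<in>I. (y i)\<^sup>2)))"
    and "integrable (PiL I) (\<lambda>y. indicator (\<Pi>\<^sub>E i\<in>I. {-R..R}) y * B)"
proof -
  let ?C = "\<Pi>\<^sub>E i\<in>I. {-R..R}"
  have C[measurable]: "?C \<in> sets (PiL I)" using I by (intro sets_PiM_I_finite) auto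
  have "emeasure (PiL I) ?C = (\<Prod>i\<in>I. ennreal (2 * R))"
    using I R by (subst lborel_PiM.emeasure_PiM) auto
  then have fin: "emeasure (PiL I) ?C < \<infinity>" using R by (simp add: ennreal_power)
  show B: "integrable (PiL I) (\<lambda>y. indicator ?C y * B)"
    by (intro integrable_mult_left integrable_real_indicator C fin)
  show "integrable (PiL I) (\<lambda>y. indicator ?C y * h (c + (\<Sum>i\<in>I. (y i)\<^sup>2)))"
  proof (rule Bochner_Integration.integrable_bound[OF B])
    show "AE y in PiL I. norm (indicat_real ?C y * h (c + (\<Sum>i\<in>I. (y i)\<^sup>2))) \<le> norm (indicat_real ?C y * B)"
    proof (rule AE_I2)
      fix y :: "'a \<Rightarrow> real"
      have "c + (\<Sum>i\<in>I. (y i)\<^sup>2) \<ge> 0" using c by (simp add: sum_nonneg)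
      from hpos[OF this] hB[OF this]
      show "norm (indicat_real ?C y * h (c + (\<Sum>i\<in>I. (y i)\<^sup>2))) \<le> norm (indicat_real ?C y * B)"
        by (auto simp: indicator_def)
    qed
  qed measurable
qed

lemma cube_integral_pos:
  assumes I: "finite I" and c: "c \<ge> 0"
  shows "cube_integral h R I c > 0"
proof -
  let ?C = "\<Pi>\<^sub>E i\<in>I. {-R..R}"
  let ?f = "\<lambda>y. h (c + (\<Sum>i\<in>I. (y i)\<^sup>2))"
  have fpos: "?f y > 0" for y using c by (intro hpos) (simp add: sum_nonneg)
  \<comment> \<open>\<open>integral_PiL_pos\<close> wants positivity at every function bounded by
    \<open>R\<close> on \<open>I\<close>, extensional or not. The cube is therefore traded for a set
    that ignores values off \<open>I\<close> and agrees with it on the space.\<close>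
  have ind: "indicator ?C y = (indicator {y. \<forall>i\<in>I. \<bar>y i\<bar> \<le> R} y :: real)" if "y \<in> space (PiL I)" for y
  proof -
    have "y \<in> ?C \<longleftrightarrow> (\<forall>i\<in>I. \<bar>y i\<bar> \<le> R)"
      using that by (auto simp: space_PiM PiE_iff abs_le_iff minus_le_iff)
    then show ?thesis by (simp add: indicator_def)
  qed
  have "(\<integral>y. indicator ?C y * ?f y \<partial>PiL I) = (\<integral>y. indicator {y. \<forall>i\<in>I. \<bar>y i\<bar> \<le> R} y * ?f y \<partial>PiL I)"
    by (intro Bochner_Integration.integral_cong) (simp_all add: ind)
  also have "\<dots> > 0"
  proof (rule integral_PiL_pos[OF I _ _ _ R])
    have "indicator ?C y * ?f y = indicator {y. \<forall>i\<in>I. \<bar>y i\<bar> \<le> R} y * ?f y" if "y \<in> space (PiL I)" for y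
      using ind[OF that] by simp
    with cube_integrand_integrable(1)[OF I c]
    show "integrable (PiL I) (\<lambda>y. indicator {y. \<forall>i\<in>I. \<bar>y i\<bar> \<le> R} y * ?f y)"
      by (rule integrable_eqI)
  qed (use fpos in \<open>auto simp: indicator_def less_imp_le\<close>)
  finally show ?thesis unfolding cube_integral_def .
qed

text \<open>Dominated convergence with the bound \<open>B\<close> on the cube. This is the
  continuity that the transport demands of the one-dimensional weight in the induction.\<close>

lemma cube_integral_continuous:
  assumes I: "finite I" and c: "c \<ge> 0"
  shows "continuous_on UNIV (\<lambda>s. cube_integral h R I (c + s\<^sup>2))"
proof (rule continuous_on_sequentiallyI)
  let ?C = "\<Pi>\<^sub>E i\<in>I. {-R..R}"
  fix u :: "nat \<Rightarrow> real" and a assume u: "u \<longlonglongrightarrow> a"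
  have nn: "c + s\<^sup>2 + (\<Sum>i\<in>I. (y i)\<^sup>2) \<ge> 0" for s y using c by (simp add: sum_nonneg)
  have C[measurable]: "?C \<in> sets (PiL I)" using I by (intro sets_PiM_I_finite) auto
  show "(\<lambda>n. cube_integral h R I (c + (u n)\<^sup>2)) \<longlonglongrightarrow> cube_integral h R I (c + a\<^sup>2)"
    unfolding cube_integral_def
  proof (rule integral_dominated_convergence)
    show "integrable (PiL I) (\<lambda>y. indicator ?C y * B)" by (rule cube_integrand_integrable(2)[OF I c])
    show "AE y in PiL I. (\<lambda>n. indicat_real ?C y * h (c + (u n)\<^sup>2 + (\<Sum>i\<in>I. (y i)\<^sup>2)))
        \<longlonglongrightarrow> indicat_real ?C y * h (c + a\<^sup>2 + (\<Sum>i\<in>I. (y i)\<^sup>2))"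
    proof (rule AE_I2)
      fix y
      have "(\<lambda>n. h (c + (u n)\<^sup>2 + (\<Sum>i\<in>I. (y i)\<^sup>2))) \<longlonglongrightarrow> h (c + a\<^sup>2 + (\<Sum>i\<in>I. (y i)\<^sup>2))"
        by (rule continuous_on_tendsto_compose[OF h]) (use nn u in \<open>auto intro!: tendsto_intros\<close>)
      then show "(\<lambda>n. indicat_real ?C y * h (c + (u n)\<^sup>2 + (\<Sum>i\<in>I. (y i)\<^sup>2)))
        \<longlonglongrightarrow> indicat_real ?C y * h (c + a\<^sup>2 + (\<Sum>i\<in>I. (y i)\<^sup>2))" by (intro tendsto_intros)
    qed
    show "AE y in PiL I. norm (indicat_real ?C y * h (c + (u n)\<^sup>2 + (\<Sum>i\<in>I. (y i)\<^sup>2))) \<le> indicat_real ?C y * B" for n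
      using hpos[OF nn] hB[OF nn] by (intro AE_I2) (auto simp: indicator_def abs_of_pos)
  qed measurable
qed

text \<open>By Fubini. The right-hand side is the constant \<open>Z\<close> of the one-dimensional
  weight left after integrating out \<open>I\<close>, so the induction passes from one normalising
  constant to the next without loss.\<close>

lemma cube_integral_insert:
  assumes I: "finite I" "i \<notin> I" and c: "c \<ge> 0"
  shows "cube_integral h R (insert i I) c = integral {-R..R} (\<lambda>s. cube_integral h R I (c + s\<^sup>2))"
proof -
  have "cube_integral h R (insert i I) c
      = (\<integral>s. \<integral>y. indicator (\<Pi>\<^sub>E i\<in>insert i I. {-R..R}) (y(i := s)) * h (c + (\<Sum>j\<in>insert i I. ((y(i := s)) j)\<^sup>2)) \<partial>PiL I \<partial>lborel)"
    unfolding cube_integral_def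
    using I c by (intro lborel_PiM.integral_fun_upd_PiM cube_integrand_integrable) auto
  also have "\<dots> = (\<integral>s. indicator {-R..R} s * cube_integral h R I (c + s\<^sup>2) \<partial>lborel)"
  proof (intro Bochner_Integration.integral_cong refl)
    fix s
    have "(\<integral>y. indicator (\<Pi>\<^sub>E i\<in>insert i I. {-R..R}) (y(i := s)) * h (c + (\<Sum>j\<in>insert i I. ((y(i := s)) j)\<^sup>2)) \<partial>PiL I)
      = (\<integral>y. indicator {-R..R} s * (indicator (\<Pi>\<^sub>E i\<in>I. {-R..R}) y * h (c + s\<^sup>2 + (\<Sum>j\<in>I. (y j)\<^sup>2))) \<partial>PiL I)"
    proof (intro Bochner_Integration.integral_cong refl)
      fix y assume y: "y \<in> space (PiL I)"
      have "(\<Sum>j\<in>I. ((y(i := s)) j)\<^sup>2) = (\<Sum>j\<in>I. (y j)\<^sup>2)"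
        using I by (intro sum.cong) auto
      moreover have "y(i := s) \<in> (\<Pi>\<^sub>E i\<in>insert i I. {-R..R}) \<longleftrightarrow> s \<in> {-R..R} \<and> y \<in> (\<Pi>\<^sub>E i\<in>I. {-R..R})"
        using I y by (auto simp: space_PiM PiE_def extensional_def Pi_iff)
      ultimately show "indicat_real (\<Pi>\<^sub>E i\<in>insert i I. {-R..R}) (y(i := s)) * h (c + (\<Sum>j\<in>insert i I. ((y(i := s)) j)\<^sup>2))
        = indicat_real {-R..R} s * (indicat_real (\<Pi>\<^sub>E i\<in>I. {-R..R}) y * h (c + s\<^sup>2 + (\<Sum>j\<in>I. (y j)\<^sup>2)))"
        using I by (simp add: indicator_def add.assoc)
    qed
    then show "(\<integral>y. indicator (\<Pi>\<^sub>E i\<in>insert i I. {-R..R}) (y(i := s)) * h (c + (\<Sum>j\<in>insert i I. ((y(i := s)) j)\<^sup>2)) \<partial>PiL I)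
      = indicator {-R..R} s * cube_integral h R I (c + s\<^sup>2)"
      by (simp add: cube_integral_def)
  qed
  also have "\<dots> = integral {-R..R} (\<lambda>s. cube_integral h R I (c + s\<^sup>2))"
  proof -
    have "set_integrable lborel {-R..R} (\<lambda>s. cube_integral h R I (c + s\<^sup>2))"
      by (intro borel_integrable_atLeastAtMost' continuous_on_subset[OF cube_integral_continuous[OF I(1) c]]) auto
    from set_borel_integral_eq_integral(2)[OF this] show ?thesis
      by (simp add: set_lebesgue_integral_def)
  qed
  finally show ?thesis .
qed

text \<open>The function \<open>\<Phi>\<close> is an integrable majorant of the supremum over \<open>y\<close>; working with a majorant
  avoids all measurability and integrability questions about that supremum and its slices. The offset
  \<open>c\<close> carries the squares of the coordinates of \<open>y\<close> already fixed by slicing.\<close>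

proposition dual_entropy_bound_PiL:
  fixes f \<Phi> :: "('i \<Rightarrow> real) \<Rightarrow> real" and D :: "'i \<Rightarrow> ('i \<Rightarrow> real) \<Rightarrow> real"
  assumes "finite I" "c \<ge> 0"
    and "\<And>x. f x > 0" and "integrable (PiL I) f"
    and "\<And>i. i \<in> I \<Longrightarrow> integrable (PiL I) (D i)"
    and "\<And>i x t. i \<in> I \<Longrightarrow> ((\<lambda>t. f (x(i := t))) has_real_derivative D i (x(i := t))) (at t)"
    and "\<And>i x. i \<in> I \<Longrightarrow> continuous_on UNIV (\<lambda>t. D i (x(i := t)))"
    and "integrable (PiL I) \<Phi>"
    and "\<And>x y. (\<And>i. i \<in> I \<Longrightarrow> y i \<in> {-R..R}) \<Longrightarrow>
      \<Phi> x \<ge> - (\<Sum>i\<in>I. y i * D i x) + f x * ln (h (c + (\<Sum>i\<in>I. (y i)\<^sup>2))) - f x * ln (f x)"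
    and "m = (\<integral>x. f x \<partial>PiL I)"
  shows "(\<integral>x. \<Phi> x \<partial>PiL I) \<ge> m * (card I + ln (cube_integral h R I c)) - m * ln m"
  using assms
proof (induction I arbitrary: c f D \<Phi> m rule: finite_induct)
  \<comment> \<open>The product space is a single point of mass one, and the claim is the assumption
    on \<open>\<Phi>\<close> at that point.\<close>
  case empty
  have "integral\<^sup>L (PiL {}) g = g (\<lambda>_. undefined)" for g :: "('i \<Rightarrow> real) \<Rightarrow> real"
    by (simp add: PiM_empty lebesgue_integral_count_space_finite)
  moreover have "cube_integral h R ({} :: 'i set) c = h c"
    by (simp add: cube_integral_def PiM_empty lebesgue_integral_count_space_finite)
  ultimately show ?case using empty.prems(8)[of undefined "\<lambda>_. undefined"] empty.prems(9) by simp
next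
  case (insert i I)
  note I = \<open>finite I\<close> \<open>i \<notin> I\<close> and c = \<open>c \<ge> 0\<close> and fpos = insert.prems(2)
  interpret P: sigma_finite_measure "PiL I" by (rule lborel_PiM.sigma_finite[OF I(1)])
  interpret PP: pair_sigma_finite lborel "PiL I" ..
  note f2 = lborel_PiM.integrable_fun_upd_PiM[OF I insert.prems(3)]
  note D2 = lborel_PiM.integrable_fun_upd_PiM[OF I insert.prems(4)]
  note \<Phi>2 = lborel_PiM.integrable_fun_upd_PiM[OF I insert.prems(7)]
  define mt where "mt = (\<lambda>t. \<integral>x. f (x(i := t)) \<partial>PiL I)"
  define dm where "dm = (\<lambda>t. \<integral>x. D i (x(i := t)) \<partial>PiL I)"
  have mt: "integrable lborel mt" unfolding mt_def using PP.integrable_fst'[OF f2] by (simp only: prod.case)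
  have dm: "integrable lborel dm" unfolding dm_def using PP.integrable_fst'[OF D2[of i]] by (simp only: prod.case insertI1)
  have line: "f (x(i := b)) - f (x(i := a)) = (\<integral>t. indicator {a..b} t * D i (x(i := t)) \<partial>lborel)"
    if "a \<le> b" for a b x
  proof -
    have d: "((\<lambda>t. f (x(i := t))) has_vector_derivative D i (x(i := t))) (at t within {a..b})" for t
      using insert.prems(5)[OF insertI1]
      unfolding has_real_derivative_iff_has_vector_derivative by (rule has_vector_derivative_at_within)
    have "(\<integral>t. indicator {a..b} t *\<^sub>R D i (x(i := t)) \<partial>lborel) = f (x(i := b)) - f (x(i := a))"
      by (rule integral_FTC_atLeastAtMost[OF that d continuous_on_subset[OF insert.prems(6)[OF insertI1] subset_UNIV]])
    then show ?thesis by (simp only: real_scaleR_def)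
  qed
  have D2': "integrable (lborel \<Otimes>\<^sub>M PiL I) (\<lambda>(t, x). indicator {a..b} t * D i (x(i := t)))" for a b
  proof -
    have int: "integrable (lborel \<Otimes>\<^sub>M PiL I)
      (\<lambda>p. indicator ({a..b} \<times> space (PiL I)) p *\<^sub>R (case p of (t, x) \<Rightarrow> D i (x(i := t))))"
      by (intro integrable_mult_indicator D2) auto
    have eq: "indicator ({a..b} \<times> space (PiL I)) p *\<^sub>R (case p of (t, x) \<Rightarrow> D i (x(i := t)))
      = (case p of (t, x) \<Rightarrow> indicator {a..b} t * D i (x(i := t)))"
      if "p \<in> space (lborel \<Otimes>\<^sub>M PiL I)" for p
      using that by (cases p) (simp add: space_pair_measure indicator_def)
    from int eq show ?thesis by (rule integrable_eqI)
  qed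
  \<comment> \<open>Fubini on the slab between \<open>a\<close> and \<open>b\<close> turns the
    identity along single lines into one for the marginals.\<close>
  have diff: "integrable (PiL I) (\<lambda>x. f (x(i := b)) - f (x(i := a)))"
    and ftc: "(\<integral>x. f (x(i := b)) - f (x(i := a)) \<partial>PiL I) = (\<integral>t. indicator {a..b} t * dm t \<partial>lborel)"
    if "a \<le> b" for a b
  proof -
    show "integrable (PiL I) (\<lambda>x. f (x(i := b)) - f (x(i := a)))"
      using PP.integrable_snd[of "\<lambda>t x. indicator {a..b} t * D i (x(i := t))"] D2'[of a b]
      by (simp add: line[OF that])
    show "(\<integral>x. f (x(i := b)) - f (x(i := a)) \<partial>PiL I) = (\<integral>t. indicator {a..b} t * dm t \<partial>lborel)"
      using PP.Fubini_integral[of "\<lambda>t x. indicator {a..b} t * D i (x(i := t))"] D2'[of a b]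
      by (simp add: line[OF that] dm_def)
  qed
  have AEf: "AE t in lborel. integrable (PiL I) (\<lambda>x. f (x(i := t)))"
    using PP.AE_integrable_fst'[OF f2] by (simp only: prod.case)
  \<comment> \<open>Fubini yields integrability for almost every t only. One good \<open>t0\<close>
    is enough, since differences of slices are integrable by \<open>diff\<close>. Every t is wanted
    because \<open>ftc'\<close> and \<open>mtpos\<close> admit no exceptional set.\<close>
  have slice: "integrable (PiL I) (\<lambda>x. f (x(i := t)))" for t
  proof -
    obtain t0 where t0: "integrable (PiL I) (\<lambda>x. f (x(i := t0)))"
      using eventually_happens[OF AEf] by (auto simp: ae_filter_eq_bot_iff)
    show ?thesis
    proof (cases "t0 \<le> t")
      case True
      from Bochner_Integration.integrable_add[OF diff[OF True] t0] show ?thesis by simp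
    next
      case False
      then have "t \<le> t0" by simp
      from Bochner_Integration.integrable_diff[OF t0 diff[OF this]] show ?thesis by simp
    qed
  qed
  have ftc': "mt b - mt a = (\<integral>t. indicator {a..b} t * dm t \<partial>lborel)" if "a \<le> b" for a b
    using ftc[OF that] slice by (simp add: mt_def)
  have mtpos: "mt t > 0" for t
    unfolding mt_def by (rule integral_PiL_pos[OF I(1) slice, of _ 1]) (use fpos in \<open>auto simp: less_imp_le\<close>)
  \<comment> \<open>The induction hypothesis contributes \<open>card I * mt t\<close>. Removing it
    leaves the hypothesis of the bound on the line, and its integral \<open>card I * m\<close>
    returns at the end and completes the dimension.\<close>
  define \<Psi> where "\<Psi> = (\<lambda>t. (\<integral>x. \<Phi> (x(i := t)) \<partial>PiL I) - card I * mt t)"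
  have i\<Phi>: "integrable lborel (\<lambda>t. \<integral>x. \<Phi> (x(i := t)) \<partial>PiL I)" using PP.integrable_fst'[OF \<Phi>2] by (simp only: prod.case)
  have \<Psi>: "integrable lborel \<Psi>" unfolding \<Psi>_def using i\<Phi> mt by simp
  define E where "E = (\<lambda>s. cube_integral h R I (c + s\<^sup>2))"
  have m: "m = (\<integral>t. mt t \<partial>lborel)"
    unfolding insert.prems(9) mt_def by (rule lborel_PiM.integral_fun_upd_PiM[OF I insert.prems(3)])
  have "AE t in lborel. \<forall>j\<in>I. integrable (PiL I) (\<lambda>x. D j (x(i := t)))"
    using PP.AE_integrable_fst'[OF D2] by (intro AE_finite_allI[OF I(1)]) (simp only: prod.case insertI2)
  moreover have "AE t in lborel. integrable (PiL I) (\<lambda>x. D i (x(i := t)))"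
    using PP.AE_integrable_fst'[OF D2[of i]] by (simp only: prod.case insertI1)
  moreover have "AE t in lborel. integrable (PiL I) (\<lambda>x. \<Phi> (x(i := t)))"
    using PP.AE_integrable_fst'[OF \<Phi>2] by (simp only: prod.case)
  \<comment> \<open>The exceptional set is a finite union of null sets and does not depend on s, so
    s may afterwards be chosen as a function of t.\<close>
  ultimately have le: "AE t in lborel. \<forall>s\<in>{-R..R}. \<Psi> t \<ge> - s * dm t + mt t * ln (E s) - mt t * ln (mt t)"
  proof eventually_elim
    case (elim t)
    show ?case
    proof
      fix s assume s: "s \<in> {-R..R}"
      \<comment> \<open>With coordinate \<open>i\<close> of y frozen at s, its linear term moves
        into the majorant and its square into the offset.\<close>
      have "(\<integral>x. \<Phi> (x(i := t)) + s * D i (x(i := t)) \<partial>PiL I)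
          \<ge> mt t * (card I + ln (cube_integral h R I (c + s\<^sup>2))) - mt t * ln (mt t)"
      proof (rule insert.IH[where f = "\<lambda>x. f (x(i := t))" and D = "\<lambda>j x. D j (x(i := t))"])
        show "((\<lambda>r. f (x(j := r, i := t))) has_real_derivative D j (x(j := r, i := t))) (at r)"
          if "j \<in> I" for j x r
        proof -
          have "j \<noteq> i" using that I by auto
          from insert.prems(5)[OF insertI2[OF that], of "x(i := t)" r]
          show ?thesis unfolding fun_upd_twist[OF \<open>j \<noteq> i\<close>] .
        qed
        show "continuous_on UNIV (\<lambda>r. D j (x(j := r, i := t)))" if "j \<in> I" for j x
        proof -
          have "j \<noteq> i" using that I by auto
          from insert.prems(6)[OF insertI2[OF that], of "x(i := t)"]
          show ?thesis unfolding fun_upd_twist[OF \<open>j \<noteq> i\<close>] .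
        qed
        show "\<Phi> (x(i := t)) + s * D i (x(i := t)) \<ge> - (\<Sum>j\<in>I. y j * D j (x(i := t)))
            + f (x(i := t)) * ln (h (c + s\<^sup>2 + (\<Sum>j\<in>I. (y j)\<^sup>2))) - f (x(i := t)) * ln (f (x(i := t)))"
          if y: "\<And>j. j \<in> I \<Longrightarrow> y j \<in> {-R..R}" for x y
        proof -
          define z where "z = x(i := t)"
          have "(\<Sum>j\<in>I. (y(i := s)) j * D j z) = (\<Sum>j\<in>I. y j * D j z)"
            "(\<Sum>j\<in>I. ((y(i := s)) j)\<^sup>2) = (\<Sum>j\<in>I. (y j)\<^sup>2)"
            using I by (auto intro!: sum.cong)
          moreover have "(y(i := s)) j \<in> {-R..R}" if "j \<in> insert i I" for j using that s y by auto
          note insert.prems(8)[of "y(i := s)" z, OF this]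
          ultimately show ?thesis unfolding z_def[symmetric] using I by (simp add: add.assoc)
        qed
        show "integrable (PiL I) (\<lambda>x. \<Phi> (x(i := t)) + s * D i (x(i := t)))"
          by (intro Bochner_Integration.integrable_add integrable_mult_right elim)
        show "mt t = (\<integral>x. f (x(i := t)) \<partial>PiL I)" by (simp only: mt_def)
        show "integrable (PiL I) (\<lambda>x. D j (x(i := t)))" if "j \<in> I" for j
          using elim(1) that by (rule bspec)
        show "c + s\<^sup>2 \<ge> 0" using c by simp
      qed (rule fpos slice)+
      also have "(\<integral>x. \<Phi> (x(i := t)) + s * D i (x(i := t)) \<partial>PiL I) = (\<integral>x. \<Phi> (x(i := t)) \<partial>PiL I) + s * dm t"
        unfolding dm_def Bochner_Integration.integral_add[OF elim(3) integrable_mult_right[OF elim(2)]]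
        by (simp only: integral_mult_right_zero)
      finally show "\<Psi> t \<ge> - s * dm t + mt t * ln (E s) - mt t * ln (mt t)"
        by (simp add: \<Psi>_def E_def algebra_simps)
    qed
  qed
  have "m * (1 + ln (integral {-R..R} E)) - m * ln m \<le> (\<integral>t. \<Psi> t \<partial>lborel)"
    by (rule dual_entropy_bound_real[OF mt mtpos dm ftc' R _ _ \<Psi> le refl m])
      (use I c in \<open>auto simp: E_def intro!: cube_integral_continuous cube_integral_pos\<close>)
  also have "(\<integral>t. \<Psi> t \<partial>lborel) = (\<integral>x. \<Phi> x \<partial>PiL (insert i I)) - card I * m"
    unfolding \<Psi>_def lborel_PiM.integral_fun_upd_PiM[OF I insert.prems(7)]
    using i\<Phi> mt by (simp add: m)
  also have "integral {-R..R} E = cube_integral h R (insert i I) c"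
    by (simp add: E_def cube_integral_insert[OF I c])
  finally show ?case using I by (simp add: algebra_simps)
qed

end

subsection \<open>Radial integrals and the bound on Euclidean space\<close>

text \<open>The function \<open>w\<close> is only required to be \<open>v powr a\<close> for \<open>v > 0\<close> because \<open>0 powr 0 = 0\<close>.\<close>

lemma nn_integral_powr_layer:
  fixes w W :: "real \<Rightarrow> real" and k q a :: real
  assumes k: "k > 0" and q: "q > 0" and a: "a \<ge> 0"
    and [measurable]: "w \<in> borel_measurable borel" and w0: "\<And>v. v \<ge> 0 \<Longrightarrow> w v \<ge> 0"
    and wa: "\<And>v. v > 0 \<Longrightarrow> w v = v powr a"
    and w: "\<And>v. v \<ge> 0 \<Longrightarrow> (W has_real_derivative - (w v * exp (- v))) (at v)"
    and W: "(W \<longlongrightarrow> 0) at_top"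
  shows "(\<integral>\<^sup>+(x::'a::euclidean_space). ennreal (W (k * norm x powr q)) \<partial>lborel)
    = ennreal (unit_ball_vol (real DIM('a)) * k powr (- (real DIM('a) / q)) * Gamma (a + real DIM('a) / q + 1))"
proof -
  define n where "n = real DIM('a)"
  \<comment> \<open>Layer cake: \<open>W\<close> at \<open>k * norm x powr q\<close> is the integral
    of \<open>w v * exp (- v)\<close> beyond that point. After exchanging the integrals, the inner
    one is the volume of a sublevel set of the norm, a ball.\<close>
  define J where "J = (\<lambda>(x::'a) v. ennreal (w v * exp (- v)) * indicator {k * norm x powr q..} v)"
  have Wx: "ennreal (W (k * norm x powr q)) = (\<integral>\<^sup>+v. J x v \<partial>lborel)" for x
  proof -
    have "(\<integral>\<^sup>+v. J x v \<partial>lborel) = ennreal (0 - - W (k * norm x powr q))"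
      unfolding J_def
    proof (rule nn_integral_FTC_atLeast)
      fix v assume "k * norm x powr q \<le> v"
      moreover have "0 \<le> k * norm x powr q" using k by simp
      ultimately have "v \<ge> 0" by linarith
      from DERIV_minus[OF w[OF this]]
      show "((\<lambda>v. - W v) has_real_derivative w v * exp (- v)) (at v)" by simp
      show "0 \<le> w v * exp (- v)" using w0[OF \<open>v \<ge> 0\<close>] by simp
    next
      show "((\<lambda>v. - W v) \<longlongrightarrow> 0) at_top" using tendsto_minus[OF W] by simp
    qed auto
    then show ?thesis by simp
  qed
  have Jm: "(\<lambda>p. J (fst p) (snd p)) \<in> borel_measurable (lborel \<Otimes>\<^sub>M lborel)"
  proof -
    have "(\<lambda>p. J (fst p) (snd p)) = (\<lambda>p. if k * norm (fst p) powr q \<le> snd p then ennreal (w (snd p) * exp (- snd p)) else 0)"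
      by (auto simp: J_def indicator_def fun_eq_iff)
    then show ?thesis by simp
  qed
  \<comment> \<open>The exponent is kept as \<open>a + n / q + 1 - 1\<close> to match the Euler
    integral for Gamma at \<open>a + n / q + 1\<close>.\<close>
  have inner: "(\<integral>\<^sup>+x. J x v \<partial>lborel)
      = ennreal (unit_ball_vol n * k powr (- (n / q))) * ennreal (indicator {0..} v * v powr (a + n / q + 1 - 1) / exp v)" if "v \<noteq> 0" for v
  proof (cases "v \<ge> 0")
    case False
    then have "J x v = 0" for x
    proof -
      have "0 \<le> k * norm x powr q" using k by simp
      with False have "\<not> k * norm x powr q \<le> v" by linarith
      then show ?thesis by (simp add: J_def)
    qed
    with False show ?thesis by simp
  next
    case True
    with \<open>v \<noteq> 0\<close> have "v > 0" by simp
    define r where "r = (v / k) powr (1 / q)"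
    have r0: "r \<ge> 0" by (simp add: r_def)
    have mem: "k * norm x powr q \<le> v \<longleftrightarrow> x \<in> cball 0 r" for x :: 'a
    proof -
      have "k * norm x powr q \<le> v \<longleftrightarrow> norm x powr q \<le> v / k" using k by (simp add: field_simps)
      also have "\<dots> \<longleftrightarrow> norm x \<le> r"
      proof
        assume "norm x powr q \<le> v / k"
        then have "(norm x powr q) powr (1 / q) \<le> r" unfolding r_def using q by (intro powr_mono2) auto
        then show "norm x \<le> r" using q by (simp add: powr_powr)
      next
        assume "norm x \<le> r"
        then have "norm x powr q \<le> r powr q" using q by (intro powr_mono2) auto
        also have "r powr q = v / k" unfolding r_def using q k True by (simp add: powr_powr)
        finally show "norm x powr q \<le> v / k" .
      qed
      finally show ?thesis by simp
    qed
    have "(\<integral>\<^sup>+x. J x v \<partial>lborel) = (\<integral>\<^sup>+x. ennreal (v powr a * exp (- v)) * indicator (cball (0::'a) r) x \<partial>lborel)"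
      by (intro nn_integral_cong) (auto simp: J_def indicator_def mem wa[OF \<open>v > 0\<close>])
    also have "\<dots> = ennreal (v powr a * exp (- v)) * emeasure lborel (cball (0::'a) r)"
      by (subst nn_integral_cmult_indicator) auto
    also have "\<dots> = ennreal (v powr a * exp (- v)) * ennreal (unit_ball_vol n * r ^ DIM('a))"
      by (subst emeasure_cball[OF r0]) (simp add: n_def)
    also have "r ^ DIM('a) = v powr (n / q) * k powr (- (n / q))"
    proof -
      have "r ^ DIM('a) = r powr n"
        by (cases "r = 0") (use r0 in \<open>auto simp: n_def powr_realpow zero_power\<close>)
      also have "\<dots> = (v / k) powr (n / q)" by (simp add: r_def powr_powr)
      also have "\<dots> = v powr (n / q) * k powr (- (n / q))"
        using True k powr_divide[of v k "n / q"] by (simp add: powr_minus_divide)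
      finally show ?thesis .
    qed
    also have "ennreal (v powr a * exp (- v)) * ennreal (unit_ball_vol n * (v powr (n / q) * k powr (- (n / q))))
       = ennreal (unit_ball_vol n * k powr (- (n / q))) * ennreal (indicator {0..} v * v powr (a + n / q + 1 - 1) / exp v)"
      using True by (simp add: ennreal_mult'[symmetric] powr_add exp_minus divide_inverse n_def ac_simps)
    finally show ?thesis .
  qed
  have "(\<integral>\<^sup>+(x::'a). ennreal (W (k * norm x powr q)) \<partial>lborel) = (\<integral>\<^sup>+x. \<integral>\<^sup>+v. J x v \<partial>lborel \<partial>lborel)"
    by (simp add: Wx)
  also have "\<dots> = (\<integral>\<^sup>+v. \<integral>\<^sup>+x. J x v \<partial>lborel \<partial>lborel)"
    using lborel_pair.Fubini'[of "\<lambda>x v. J x v"] Jm by (simp add: split_beta')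
  also have "\<dots> = (\<integral>\<^sup>+v. ennreal (unit_ball_vol n * k powr (- (n / q)))
      * ennreal (indicator {0..} v * v powr (a + n / q + 1 - 1) / exp v) \<partial>lborel)"
  proof (rule nn_integral_cong_AE)
    have "AE v in lborel. v \<noteq> (0::real)" by (rule AE_lborel_singleton)
    then show "AE v in lborel. (\<integral>\<^sup>+x. J x v \<partial>lborel) = ennreal (unit_ball_vol n * k powr (- (n / q)))
      * ennreal (indicator {0..} v * v powr (a + n / q + 1 - 1) / exp v)"
      by eventually_elim (rule inner)
  qed
  also have "\<dots> = ennreal (unit_ball_vol n * k powr (- (n / q)))
      * (\<integral>\<^sup>+v. ennreal (indicator {0..} v * v powr (a + n / q + 1 - 1) / exp v) \<partial>lborel)"
    by (rule nn_integral_cmult) simp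
  also have "(\<integral>\<^sup>+v. ennreal (indicator {0..} v * v powr (a + n / q + 1 - 1) / exp v) \<partial>lborel)
      = ennreal (Gamma (a + n / q + 1))"
    using Gamma_conv_nn_integral_real[of "a + n / q + 1"] a q by (simp add: n_def add_nonneg_pos)
  also have "ennreal (unit_ball_vol n * k powr (- (n / q))) * ennreal (Gamma (a + n / q + 1))
     = ennreal (unit_ball_vol n * k powr (- (n / q)) * Gamma (a + n / q + 1))"
    by (subst ennreal_mult'[symmetric]) (simp_all add: n_def)
  finally show ?thesis by (simp add: n_def)
qed

text \<open>The layer formula with \<open>w\<close> constantly 1 gives the mass. With
  \<open>w v = v\<close> the tail function is \<open>(v + 1) * exp (- v)\<close>, and the Gamma
  recursion yields the mass times \<open>DIM('a) / q + 1\<close>. Subtracting the mass and dividing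
  by \<open>k\<close> leaves the moment.\<close>

lemma
  fixes k q :: real
  assumes k: "k > 0" and q: "q > 0"
  defines "Z \<equiv> unit_ball_vol (real DIM('a)) * k powr (- (real DIM('a) / q)) * Gamma (real DIM('a) / q + 1)"
  shows has_bochner_integral_exp_norm_powr:
      "has_bochner_integral lborel (\<lambda>x::'a::euclidean_space. exp (- k * norm x powr q)) Z"
    and has_bochner_integral_norm_powr_exp:
      "has_bochner_integral lborel (\<lambda>x::'a. norm x powr q * exp (- k * norm x powr q)) (real DIM('a) / (q * k) * Z)"
proof -
  have Gp: "Gamma (real DIM('a) / q + 1) > 0" using q by (intro Gamma_real_pos) (simp add: add_nonneg_pos)
  have Z0: "Z > 0" unfolding Z_def using Gp k by simp
  have "(\<integral>\<^sup>+(x::'a). ennreal (exp (- (k * norm x powr q))) \<partial>lborel)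
      = ennreal (unit_ball_vol (real DIM('a)) * k powr (- (real DIM('a) / q)) * Gamma (0 + real DIM('a) / q + 1))"
  proof (rule nn_integral_powr_layer[OF k q, where w = "\<lambda>_. 1"])
    show "((\<lambda>v. exp (- v)) has_real_derivative - (1 * exp (- v))) (at v)" for v :: real
      by (auto intro!: derivative_eq_intros)
    show "((\<lambda>v::real. exp (- v)) \<longlongrightarrow> 0) at_top" by real_asymp
  qed auto
  then have "(\<integral>\<^sup>+(x::'a). ennreal (exp (- (k * norm x powr q))) \<partial>lborel) = ennreal Z" by (simp add: Z_def)
  then show 1: "has_bochner_integral lborel (\<lambda>x::'a. exp (- k * norm x powr q)) Z"
    using Z0 by (intro has_bochner_integral_nn_integral) auto
  have "(\<integral>\<^sup>+(x::'a). ennreal ((k * norm x powr q + 1) * exp (- (k * norm x powr q))) \<partial>lborel)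
      = ennreal (unit_ball_vol (real DIM('a)) * k powr (- (real DIM('a) / q)) * Gamma (1 + real DIM('a) / q + 1))"
  proof (rule nn_integral_powr_layer[OF k q, where w = "\<lambda>v. v"])
    show "((\<lambda>v. (v + 1) * exp (- v)) has_real_derivative - (v * exp (- v))) (at v)" for v :: real
      by (auto intro!: derivative_eq_intros simp: algebra_simps)
    show "((\<lambda>v::real. (v + 1) * exp (- v)) \<longlongrightarrow> 0) at_top" by real_asymp
  qed auto
  also have "Gamma (1 + real DIM('a) / q + 1) = (real DIM('a) / q + 1) * Gamma (real DIM('a) / q + 1)"
  proof -
    have "real DIM('a) / q + 1 > 0" using q by (simp add: add_nonneg_pos)
    then have "real DIM('a) / q + 1 \<notin> \<int>\<^sub>\<le>\<^sub>0" by (metis nonpos_Ints_nonpos not_less)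
    from Gamma_plus1[OF this] show ?thesis by (simp add: ac_simps)
  qed
  finally have "(\<integral>\<^sup>+(x::'a). ennreal ((k * norm x powr q + 1) * exp (- (k * norm x powr q))) \<partial>lborel)
      = ennreal ((real DIM('a) / q + 1) * Z)"
    by (simp add: Z_def ac_simps)
  then have "has_bochner_integral lborel (\<lambda>x::'a. (k * norm x powr q + 1) * exp (- (k * norm x powr q)))
      ((real DIM('a) / q + 1) * Z)"
    using k q Z0 by (intro has_bochner_integral_nn_integral) auto
  from has_bochner_integral_mult_right[OF has_bochner_integral_diff[OF this 1], of "1 / k"]
  show "has_bochner_integral lborel (\<lambda>x::'a. norm x powr q * exp (- k * norm x powr q)) (real DIM('a) / (q * k) * Z)"
    using k by (simp add: algebra_simps)
qed

text \<open>The assumption holds for all y, so one majorant \<open>\<Phi>\<close> serves every cube,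
  and the cube integrals converge to the full integral as the cubes grow. Coordinates with respect
  to \<open>Basis\<close> carry the product measure to \<open>lborel\<close>.\<close>

proposition dual_entropy_bound_euclidean:
  fixes f \<Phi> :: "'a::euclidean_space \<Rightarrow> real" and g :: "'a \<Rightarrow> 'a" and k q :: real
  assumes fpos: "\<And>x. f x > 0" and f: "integrable lborel f" and f1: "(\<integral>x. f x \<partial>lborel) = 1"
    and df: "\<And>x. (f has_derivative (\<lambda>v. g x \<bullet> v)) (at x)"
    and gcont: "continuous_on UNIV g" and g: "integrable lborel g"
    and k: "k > 0" and q: "q > 0"
    and \<Phi>: "integrable lborel \<Phi>"
    and le: "\<And>x y. \<Phi> x \<ge> - (y \<bullet> g x) - f x * (k * norm y powr q) - f x * ln (f x)"
  shows "(\<integral>x. \<Phi> x \<partial>lborel) \<ge> real DIM('a) + ln (\<integral>(y::'a). exp (- k * norm y powr q) \<partial>lborel)"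
proof -
  define S :: "('a \<Rightarrow> real) \<Rightarrow> 'a" where "S = (\<lambda>x. \<Sum>b\<in>Basis. x b *\<^sub>R b)"
  define h where "h = (\<lambda>v. exp (- k * sqrt v powr q))"
  have L: "lborel = distr (PiL Basis) borel S" unfolding S_def by (rule lborel_eq)
  have Sm[measurable]: "S \<in> measurable (PiL Basis) borel" unfolding S_def by measurable
  have int: "integrable (PiL Basis) (\<lambda>x. \<phi> (S x))" if "integrable lborel \<phi>" for \<phi> :: "'a \<Rightarrow> real"
    using that by (subst (asm) L) (erule integrable_distr[OF Sm])
  have eq: "(\<integral>x. \<phi> (S x) \<partial>PiL Basis) = (\<integral>x. \<phi> x \<partial>lborel)" if "\<phi> \<in> borel_measurable borel" for \<phi> :: "'a \<Rightarrow> real"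
    by (subst L) (rule integral_distr[OF Sm that, symmetric])
  have Sb: "S x \<bullet> b = x b" if "b \<in> Basis" for x b
    using that unfolding S_def by simp
  have Snorm: "sqrt (\<Sum>b\<in>Basis. (x b)\<^sup>2) = norm (S x)" for x
    unfolding norm_eq_sqrt_inner by (subst euclidean_inner) (simp add: Sb power2_eq_square)
  \<comment> \<open>The vector without its \<open>b\<close> component: it makes
    \<open>S (x(b := t))\<close> visibly affine in t, so that the chain rule applies.\<close>
  define S' where "S' = (\<lambda>x b. \<Sum>b'\<in>Basis - {b}. x b' *\<^sub>R b' :: 'a)"
  have Supd: "S (x(b := t)) = S' x b + t *\<^sub>R b" if "b \<in> Basis" for x b t
    unfolding S_def S'_def by (subst sum.remove[OF finite_Basis that]) (auto intro: sum.cong)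
  have cont: "continuous_on {0..} h"
    unfolding h_def using q by (intro continuous_intros continuous_on_powr') auto
  have hle1: "h v \<le> 1" if "v \<ge> 0" for v unfolding h_def using k by simp
  have hm: "h \<in> borel_measurable borel" unfolding h_def by measurable
  have hS: "h (0 + (\<Sum>b\<in>Basis. (x b)\<^sup>2)) = exp (- k * norm (S x) powr q)" for x
    by (simp add: h_def Snorm)
  define Z where "Z = (\<integral>(y::'a). exp (- k * norm y powr q) \<partial>lborel)"
  have Zi: "integrable lborel (\<lambda>y::'a. exp (- k * norm y powr q))"
    using has_bochner_integral_exp_norm_powr[OF k q] by (auto simp: has_bochner_integral_iff)
  \<comment> \<open>\<open>Suc n\<close> keeps the half-width positive from the start.\<close>
  define c where "c = (\<lambda>n. cube_integral h (real (Suc n)) (Basis :: 'a set) 0)"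
  have bound: "(\<integral>x. \<Phi> x \<partial>lborel) \<ge> real DIM('a) + ln (c n)" for n
  proof -
    have "(\<integral>x. \<Phi> (S x) \<partial>PiL Basis) \<ge> 1 * (card (Basis :: 'a set) + ln (c n)) - 1 * ln 1"
      unfolding c_def
    proof (rule dual_entropy_bound_PiL[where f = "\<lambda>x. f (S x)" and D = "\<lambda>b x. g (S x) \<bullet> b" and h = h and B = 1])
      show "((\<lambda>t. f (S (x(b := t)))) has_real_derivative g (S (x(b := t))) \<bullet> b) (at t)" if b: "b \<in> Basis" for b x t
      proof -
        have "((\<lambda>t. S' x b + t *\<^sub>R b) has_derivative (\<lambda>r. r *\<^sub>R b)) (at t)"
          by (auto intro!: derivative_eq_intros)
        from has_derivative_compose[OF this df]
        have "((\<lambda>t. f (S' x b + t *\<^sub>R b)) has_derivative (\<lambda>r. (g (S' x b + t *\<^sub>R b) \<bullet> b) * r)) (at t)"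
          by (simp add: mult.commute)
        then show ?thesis unfolding Supd[OF b] has_field_derivative_def .
      qed
      show "continuous_on UNIV (\<lambda>t. g (S (x(b := t))) \<bullet> b)" if b: "b \<in> Basis" for b x
        unfolding Supd[OF b]
        by (intro continuous_intros continuous_on_compose2[OF gcont]) auto
      show "1 = (\<integral>x. f (S x) \<partial>PiL Basis)" using eq[of f] f f1 by simp
      show "integrable (PiL Basis) (\<lambda>x. g (S x) \<bullet> b)" for b
        using int[of "\<lambda>x. g x \<bullet> b"] g by simp
      show "\<Phi> (S x) \<ge> - (\<Sum>b\<in>Basis. y b * (g (S x) \<bullet> b)) + f (S x) * ln (h (0 + (\<Sum>b\<in>Basis. (y b)\<^sup>2))) - f (S x) * ln (f (S x))" for x y
      proof -
        have "S y \<bullet> g (S x) = (\<Sum>b\<in>Basis. y b * (g (S x) \<bullet> b))"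
          by (subst euclidean_inner) (simp add: Sb)
        then show ?thesis using le[of "S y" "S x"] by (simp add: hS del: add_0)
      qed
      show "integrable (PiL Basis) (\<lambda>x. f (S x))" by (rule int[OF f])
      show "integrable (PiL Basis) (\<lambda>x. \<Phi> (S x))" by (rule int[OF \<Phi>])
    qed (use cont hle1 hm fpos in \<open>auto simp: h_def\<close>)
    then show ?thesis using eq[of \<Phi>] \<Phi> by simp
  qed
  have "c \<longlonglongrightarrow> (\<integral>y. exp (- k * norm (S y) powr q) \<partial>PiL Basis)"
    unfolding c_def cube_integral_def hS
  proof (rule integral_dominated_convergence)
    show "integrable (PiL Basis) (\<lambda>y. exp (- k * norm (S y) powr q))" by (rule int[OF Zi])
    show "(\<lambda>y. indicat_real (\<Pi>\<^sub>E i\<in>Basis. {- real (Suc n)..real (Suc n)}) y * exp (- k * norm (S y) powr q)) \<in> borel_measurable (PiL Basis)" for n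
    proof -
      have [measurable]: "(\<Pi>\<^sub>E i\<in>Basis. {- real (Suc n)..real (Suc n)}) \<in> sets (PiL (Basis :: 'a set))"
        by (intro sets_PiM_I_finite) auto
      show ?thesis by measurable
    qed
    show "AE y in PiL Basis. (\<lambda>n. indicat_real (\<Pi>\<^sub>E i\<in>Basis. {- real (Suc n)..real (Suc n)}) y * exp (- k * norm (S y) powr q))
        \<longlonglongrightarrow> exp (- k * norm (S y) powr q)"
    proof (rule AE_I2)
      fix y :: "'a \<Rightarrow> real" assume y: "y \<in> space (PiL Basis)"
      obtain N :: nat where N: "norm (S y) \<le> real N" using real_arch_simple by blast
      have "y \<in> (\<Pi>\<^sub>E i\<in>Basis. {- real (Suc n)..real (Suc n)})" if "n \<ge> N" for n
      proof -
        have "\<bar>y b\<bar> \<le> real (Suc n)" if "b \<in> Basis" for b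
          using Basis_le_norm[OF that, of "S y"] N \<open>n \<ge> N\<close> by (simp add: Sb[OF that])
        then have "y b \<in> {- real (Suc n)..real (Suc n)}" if "b \<in> Basis" for b
          using that by (fastforce simp: abs_le_iff)
        then show ?thesis using y by (simp add: space_PiM PiE_iff)
      qed
      then have "eventually (\<lambda>n. indicat_real (\<Pi>\<^sub>E i\<in>Basis. {- real (Suc n)..real (Suc n)}) y * exp (- k * norm (S y) powr q)
          = exp (- k * norm (S y) powr q)) sequentially"
        by (intro eventually_sequentiallyI[of N]) simp
      then show "(\<lambda>n. indicat_real (\<Pi>\<^sub>E i\<in>Basis. {- real (Suc n)..real (Suc n)}) y * exp (- k * norm (S y) powr q))
        \<longlonglongrightarrow> exp (- k * norm (S y) powr q)" by (rule tendsto_eventually)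
    qed
    show "AE y in PiL Basis. norm (indicat_real (\<Pi>\<^sub>E i\<in>Basis. {- real (Suc n)..real (Suc n)}) y * exp (- k * norm (S y) powr q))
      \<le> exp (- k * norm (S y) powr q)" for n
      by (auto simp: indicator_def)
  qed measurable
  also have "(\<integral>y. exp (- k * norm (S y) powr q) \<partial>PiL Basis) = Z"
    unfolding Z_def by (rule eq) measurable
  finally have "c \<longlonglongrightarrow> Z" .
  moreover have "Z > 0"
  proof -
    have "Z = unit_ball_vol (real DIM('a)) * k powr (- (real DIM('a) / q)) * Gamma (real DIM('a) / q + 1)"
      unfolding Z_def using has_bochner_integral_exp_norm_powr[OF k q] by (rule has_bochner_integral_integral_eq)
    then show ?thesis using k q by (simp add: add_nonneg_pos)
  qed
  ultimately have "(\<lambda>n. real DIM('a) + ln (c n)) \<longlonglongrightarrow> real DIM('a) + ln Z" by (intro tendsto_intros) auto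
  then show ?thesis unfolding Z_def[symmetric]
    by (rule LIMSEQ_le_const2) (use bound in auto)
qed

subsection \<open>Decay, gradients and optimisation of the scale\<close>

text \<open>Each \<open>1 + (x \<bullet> b)\<^sup>2\<close> is at most
  \<open>1 + (norm x)\<^sup>2\<close>, so the function lies below a product of one-dimensional
  Cauchy profiles, each integrable by the arctangent. Decay is measured against this
  function.\<close>

lemma integrable_inverse_1_plus_norm_square:
  "integrable lborel (\<lambda>x::'a::euclidean_space. 1 / (1 + (norm x)\<^sup>2) ^ DIM('a))"
proof -
  define \<phi> :: "real \<Rightarrow> real" where "\<phi> = (\<lambda>t. 1 / (1 + t\<^sup>2))"
  have [measurable]: "\<phi> \<in> borel_measurable borel" unfolding \<phi>_def by measurable
  have half: "(\<integral>\<^sup>+t. ennreal (\<phi> t) * indicator {0..} t \<partial>lborel) = ennreal (pi / 2 - arctan 0)"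
  proof (rule nn_integral_FTC_atLeast)
    show "(arctan has_real_derivative \<phi> x) (at x)" for x
      unfolding \<phi>_def using DERIV_arctan[of x] by (simp add: divide_inverse)
  qed (auto simp: \<phi>_def tendsto_arctan_at_top)
  have "(\<integral>\<^sup>+t. ennreal (\<phi> t) * indicator {0..} t \<partial>lborel)
      = ennreal \<bar>-1\<bar> * (\<integral>\<^sup>+t. ennreal (\<phi> (0 + (-1) * t)) * indicator {0..} (0 + (-1) * t) \<partial>lborel)"
    by (rule nn_integral_real_affine) auto
  then have half': "(\<integral>\<^sup>+t. ennreal (\<phi> t) * indicator {..0} t \<partial>lborel) = ennreal (pi / 2)"
    using half by (simp add: \<phi>_def indicator_def)
  have "(\<integral>\<^sup>+t. ennreal (\<phi> t) \<partial>lborel) \<le> (\<integral>\<^sup>+t. ennreal (\<phi> t) * indicator {0..} t + ennreal (\<phi> t) * indicator {..0} t \<partial>lborel)"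
    by (intro nn_integral_mono) (auto simp: indicator_def)
  also have "\<dots> = ennreal (pi / 2) + ennreal (pi / 2)"
    using half half' by (subst nn_integral_add) auto
  also have "\<dots> < \<infinity>" by simp
  finally have fin: "(\<integral>\<^sup>+t. ennreal (\<phi> t) \<partial>lborel) < \<infinity>" .
  show ?thesis
  proof (rule integrableI_bounded)
    have prod: "ennreal (norm (1 / (1 + (norm x)\<^sup>2) ^ DIM('a))) \<le> (\<Prod>b\<in>Basis. ennreal (\<phi> (x \<bullet> b)))" for x :: 'a
    proof -
      have "(\<Prod>b\<in>(Basis :: 'a set). 1 + (x \<bullet> b)\<^sup>2) \<le> (\<Prod>b\<in>(Basis :: 'a set). 1 + (norm x)\<^sup>2)"
      proof (intro prod_mono conjI)
        fix b :: 'a assume "b \<in> Basis"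
        then have "(x \<bullet> b)\<^sup>2 \<le> (norm x)\<^sup>2"
          using Basis_le_norm[of b x] by (metis abs_ge_zero power2_abs power_mono)
        then show "1 + (x \<bullet> b)\<^sup>2 \<le> 1 + (norm x)\<^sup>2" by simp
      qed (simp add: add_nonneg_nonneg)
      moreover have "(\<Prod>b\<in>(Basis :: 'a set). 1 + (x \<bullet> b)\<^sup>2) > 0"
        by (intro prod_pos) (simp add: add_pos_nonneg)
      ultimately have "1 / (1 + (norm x)\<^sup>2) ^ DIM('a) \<le> (\<Prod>b\<in>(Basis :: 'a set). \<phi> (x \<bullet> b))"
        by (simp add: \<phi>_def prod_dividef frac_le)
      moreover have "(\<Prod>b\<in>(Basis :: 'a set). ennreal (\<phi> (x \<bullet> b))) = ennreal (\<Prod>b\<in>(Basis :: 'a set). \<phi> (x \<bullet> b))"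
        by (intro prod_ennreal) (simp add: \<phi>_def)
      ultimately show ?thesis by (simp add: ennreal_leI)
    qed
    have "(\<integral>\<^sup>+(x::'a). ennreal (norm (1 / (1 + (norm x)\<^sup>2) ^ DIM('a))) \<partial>lborel)
        \<le> (\<integral>\<^sup>+(x::'a). (\<Prod>b\<in>Basis. ennreal (\<phi> (x \<bullet> b))) \<partial>lborel)"
      by (intro nn_integral_mono prod)
    also have "\<dots> = (\<Prod>b\<in>(Basis :: 'a set). \<integral>\<^sup>+t. ennreal (\<phi> t) \<partial>lborel)"
      by (rule nn_integral_lborel_prod) auto
    also have "\<dots> < \<infinity>" using fin by (simp add: power_less_top_ennreal)
    finally show "(\<integral>\<^sup>+(x::'a). ennreal (norm (1 / (1 + (norm x)\<^sup>2) ^ DIM('a))) \<partial>lborel) < \<infinity>" .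
  qed measurable
qed

text \<open>Below 1, the tangent bound for \<open>ln\<close> at \<open>t powr (- \<alpha>)\<close>
  gives \<open>\<bar>ln t\<bar> \<le> t powr (- \<alpha>) / \<alpha>\<close>. Above 1, both factors
  are bounded in terms of \<open>A\<close>.\<close>

lemma powr_times_abs_ln_bounded:
  fixes \<alpha> A :: real
  assumes "\<alpha> > 0" and "A \<ge> 1"
  shows "\<exists>K. \<forall>t. 0 < t \<longrightarrow> t \<le> A \<longrightarrow> t powr \<alpha> * \<bar>ln t\<bar> \<le> K"
proof (intro exI allI impI)
  fix t :: real assume t: "0 < t" "t \<le> A"
  show "t powr \<alpha> * \<bar>ln t\<bar> \<le> max (1 / \<alpha>) (A powr \<alpha> * A)"
  proof (cases "t \<ge> 1")
    case True
    have "t powr \<alpha> * \<bar>ln t\<bar> \<le> A powr \<alpha> * A"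
      using assms t True ln_le_minus_one[of t] by (intro mult_mono powr_mono2) auto
    then show ?thesis by simp
  next
    case False
    have "- ln t * \<alpha> = ln (t powr (- \<alpha>))" using t by (simp add: ln_powr)
    also have "\<dots> \<le> t powr (- \<alpha>)" using ln_le_minus_one[of "t powr (- \<alpha>)"] t by simp
    finally have "\<bar>ln t\<bar> \<le> t powr (- \<alpha>) / \<alpha>"
      using assms t False by (simp add: field_simps)
    then have "t powr \<alpha> * \<bar>ln t\<bar> \<le> t powr \<alpha> * (t powr (- \<alpha>) / \<alpha>)"
      by (intro mult_left_mono) auto
    also have "\<dots> = 1 / \<alpha>" using t by (simp add: powr_minus field_simps)
    finally show ?thesis by simp
  qed
qed

text \<open>The seminorms of orders 0 and \<open>2 * N\<close> without derivatives are combined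
  through \<open>(1 + r\<^sup>2) ^ N \<le> 2 ^ N * (1 + r ^ (2 * N))\<close>. The order
  \<open>N\<close> is free because p - 1, the power of \<open>u\<close> to be integrated, may be
  small.\<close>

lemma rapidly_decaying_le:
  fixes u :: "real^'n::finite \<Rightarrow> real"
  assumes "rapidly_decaying u"
  obtains A where "A \<ge> 1" "\<And>x::real^'n. u x \<le> A / (1 + (norm x)\<^sup>2) ^ N"
proof -
  have "bounded (range (\<lambda>x. norm x ^ k * u x))" for k
    using assms[unfolded rapidly_decaying_def, rule_format, of k "[]"]
    by (simp add: iterated_partial_def)
  then have "\<exists>B. \<forall>x. \<bar>norm x ^ k * u x\<bar> \<le> B" for k
    by (auto simp: bounded_iff)
  then obtain B where B: "\<And>k x. \<bar>norm x ^ k * u x\<bar> \<le> B k" by metis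
  define A where "A = max 1 (2 ^ N * (B 0 + B (2 * N)))"
  show ?thesis
  proof (rule that[of A])
    fix x :: "real^'n"
    have pos: "(1 + (norm x)\<^sup>2) ^ N > 0" by (simp add: add_pos_nonneg)
    have "(1 + (norm x)\<^sup>2) ^ N \<le> (2 * max 1 ((norm x)\<^sup>2)) ^ N"
      by (intro power_mono) (auto simp: max_def add_nonneg_nonneg)
    also have "\<dots> = 2 ^ N * max 1 ((norm x)\<^sup>2) ^ N" by (simp add: power_mult_distrib)
    also have "max 1 ((norm x)\<^sup>2) ^ N \<le> 1 + norm x ^ (2 * N)"
      by (auto simp: max_def power_mult)
    finally have le: "(1 + (norm x)\<^sup>2) ^ N \<le> 2 ^ N * (1 + norm x ^ (2 * N))" by simp
    have "u x * (1 + (norm x)\<^sup>2) ^ N \<le> \<bar>u x\<bar> * (2 ^ N * (1 + norm x ^ (2 * N)))"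
      using le pos by (intro mult_mono) auto
    also have "\<dots> = 2 ^ N * (\<bar>norm x ^ 0 * u x\<bar> + \<bar>norm x ^ (2 * N) * u x\<bar>)"
      by (simp add: abs_mult algebra_simps)
    also have "\<dots> \<le> 2 ^ N * (B 0 + B (2 * N))"
      by (intro mult_left_mono add_mono B) auto
    also have "\<dots> \<le> A" by (simp add: A_def)
    finally show "u x \<le> A / (1 + (norm x)\<^sup>2) ^ N" using pos by (simp add: field_simps)
  qed (simp add: A_def)
qed

text \<open>Split \<open>u x powr \<alpha>\<close> into two equal powers: one absorbs the logarithm,
  the other is integrable by decay. This makes the Bochner integral in the entropy a genuine
  one.\<close>

lemma integrable_powr_ln_of_decay:
  fixes u :: "real^'n::finite \<Rightarrow> real"
  assumes upos: "\<And>x. u x > 0" and um: "u \<in> borel_measurable borel"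
    and decay: "rapidly_decaying u" and \<alpha>: "\<alpha> > 0"
  shows "integrable lborel (\<lambda>x. u x powr \<alpha> * ln (u x powr \<alpha>))"
proof -
  note um[measurable]
  define n where "n = DIM(real^'n)"
  \<comment> \<open>Chosen so that the power \<open>\<alpha> / 2\<close> of a decay of order
    \<open>N\<close> still has order at least \<open>n\<close>.\<close>
  obtain N :: nat where N: "2 * real n / \<alpha> \<le> real N" using real_arch_simple by blast
  obtain A where A: "A \<ge> 1" and uA: "\<And>x. u x \<le> A / (1 + (norm x)\<^sup>2) ^ N"
    using rapidly_decaying_le[OF decay] by blast
  have one: "1 \<le> 1 + (norm x)\<^sup>2" for x :: "real^'n" by simp
  have uA': "u x \<le> A" for x
  proof -
    have "A / (1 + (norm x)\<^sup>2) ^ N \<le> A / 1"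
      using A by (intro divide_left_mono one_le_power one) (simp_all add: add_pos_nonneg)
    with uA[of x] show ?thesis by simp
  qed
  obtain K where K: "\<And>t. 0 < t \<Longrightarrow> t \<le> A \<Longrightarrow> t powr (\<alpha> / 2) * \<bar>ln t\<bar> \<le> K"
    using powr_times_abs_ln_bounded[of "\<alpha> / 2" A] \<alpha> A by auto
  have K0: "K \<ge> 0"
    using K[of 1] A by simp
  have dom: "u x powr (\<alpha> / 2) \<le> A powr (\<alpha> / 2) * (1 / (1 + (norm x)\<^sup>2) ^ n)" for x
  proof -
    have "u x powr (\<alpha> / 2) \<le> (A / (1 + (norm x)\<^sup>2) ^ N) powr (\<alpha> / 2)"
      using upos[of x] uA[of x] \<alpha> by (intro powr_mono2) auto
    also have "\<dots> = A powr (\<alpha> / 2) / (1 + (norm x)\<^sup>2) powr (real N * (\<alpha> / 2))"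
      using A one[of x] by (simp add: powr_divide powr_powr powr_realpow[symmetric] add_pos_nonneg)
    also have "\<dots> \<le> A powr (\<alpha> / 2) / (1 + (norm x)\<^sup>2) powr (real n)"
    proof (intro divide_left_mono powr_mono)
      show "real n \<le> real N * (\<alpha> / 2)" using N \<alpha> by (simp add: field_simps)
      have "1 + (norm x)\<^sup>2 > 0" using one[of x] by linarith
      then show "0 < (1 + (norm x)\<^sup>2) powr (real N * (\<alpha> / 2)) * (1 + (norm x)\<^sup>2) powr real n" by simp
    qed auto
    also have "(1 + (norm x)\<^sup>2) powr (real n) = (1 + (norm x)\<^sup>2) ^ n"
      using one[of x] by (intro powr_realpow) linarith
    finally show ?thesis by simp
  qed
  show ?thesis
  proof (rule Bochner_Integration.integrable_bound)
    show "integrable lborel (\<lambda>x::real^'n. \<alpha> * K * (A powr (\<alpha> / 2) * (1 / (1 + (norm x)\<^sup>2) ^ n)))"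
      unfolding n_def by (intro integrable_mult_right integrable_inverse_1_plus_norm_square)
    show "AE x in lborel. norm (u x powr \<alpha> * ln (u x powr \<alpha>))
      \<le> norm (\<alpha> * K * (A powr (\<alpha> / 2) * (1 / (1 + (norm x)\<^sup>2) ^ n)))"
    proof (rule AE_I2)
      fix x :: "real^'n"
      have "norm (u x powr \<alpha> * ln (u x powr \<alpha>)) = \<alpha> * (u x powr (\<alpha> / 2) * (u x powr (\<alpha> / 2) * \<bar>ln (u x)\<bar>))"
        using \<alpha> upos[of x] by (simp add: ln_powr abs_mult powr_add[symmetric] mult.assoc[symmetric])
      also have "\<dots> \<le> \<alpha> * (A powr (\<alpha> / 2) * (1 / (1 + (norm x)\<^sup>2) ^ n) * K)"
        using \<alpha> K0 by (intro mult_left_mono mult_mono dom K upos uA') auto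
      also have "\<dots> \<le> norm (\<alpha> * K * (A powr (\<alpha> / 2) * (1 / (1 + (norm x)\<^sup>2) ^ n)))"
        unfolding real_norm_def by (rule order_trans[OF eq_refl abs_ge_self]) (simp add: ac_simps)
      finally show "norm (u x powr \<alpha> * ln (u x powr \<alpha>))
        \<le> norm (\<alpha> * K * (A powr (\<alpha> / 2) * (1 / (1 + (norm x)\<^sup>2) ^ n)))" .
    qed
  qed measurable
qed

section \<open>Gradients of smooth functions\<close>

lemma gradient_eqI:
  assumes "GDERIV f x :> D"
  shows "gradient f x = D"
proof -
  have "E = D" if "GDERIV f x :> E" for E
  proof -
    have "(\<lambda>h. inner h E) = (\<lambda>h. inner h D)"
      using that assms unfolding gderiv_def by (rule has_derivative_unique)
    then show ?thesis by (metis inner_commute vector_eq_rdot)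
  qed
  with assms show ?thesis unfolding gradient_def by blast
qed

text \<open>Multi-indices of length at most one enter: the empty one makes \<open>u\<close>
  differentiable, so its gradient is the vector of partial derivatives, and those of length one make
  each partial derivative differentiable, hence continuous.\<close>

lemma
  fixes u :: "real^'n::finite \<Rightarrow> real"
  assumes "smooth u"
  shows smooth_gradient: "(u has_derivative (\<lambda>v. gradient u x \<bullet> v)) (at x)"
    and smooth_continuous_gradient: "continuous_on UNIV (gradient u)"
proof -
  have diff: "u differentiable (at x)" and diff': "partial i u differentiable (at x)" for x i
    using assms[unfolded smooth_def, rule_format, of "[]" x] assms[unfolded smooth_def, rule_format, of "[i]" x]
    by (simp_all add: iterated_partial_def)
  define D where "D = (\<lambda>x. \<chi> i. partial i u x)"
  have der: "(u has_derivative (\<lambda>v. v \<bullet> D x)) (at x)" for x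
  proof -
    let ?F = "frechet_derivative u (at x)"
    have F: "(u has_derivative ?F) (at x)" using diff frechet_derivative_works by blast
    have "?F v = v \<bullet> D x" for v
    proof -
      have lin: "linear ?F" using F by (rule has_derivative_linear)
      have "?F v = ?F (\<Sum>i\<in>UNIV. (v $ i) *\<^sub>R axis i 1)"
        by (simp add: basis_expansion scalar_mult_eq_scaleR[symmetric])
      also have "\<dots> = (\<Sum>i\<in>UNIV. v $ i * ?F (axis i 1))"
        by (simp add: linear_sum[OF lin] linear_cmul[OF lin])
      also have "\<dots> = v \<bullet> D x"
        by (simp add: inner_vec_def D_def partial_def)
      finally show ?thesis .
    qed
    then have "?F = (\<lambda>v. v \<bullet> D x)" by auto
    with F show ?thesis by simp
  qed
  have gr: "gradient u = D"
    using der by (auto intro!: gradient_eqI simp: gderiv_def)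
  show "(u has_derivative (\<lambda>v. gradient u x \<bullet> v)) (at x)"
    using der[of x] by (simp add: gr inner_commute)
  have "continuous_on UNIV (partial i u)" for i
    using diff' by (intro differentiable_imp_continuous_on) (simp add: differentiable_on_def)
  then show "continuous_on UNIV (gradient u)"
    unfolding gr D_def by (intro continuous_on_vec_lambda)
qed

section \<open>The sharp constant and the optimal scale\<close>

lemma conj_exponent_props:
  assumes "p > 1"
  shows "conj_exponent p > 1" "1 / p + 1 / conj_exponent p = 1" "p / conj_exponent p = p - 1"
    "(conj_exponent p - 1) * p = conj_exponent p" "conj_exponent p * (p - 1) = p"
  using assms by (auto simp: conj_exponent_def field_simps)

lemma ln_gamma_const:
  assumes p: "p > 1" and n: "n > 0"
  defines "q \<equiv> conj_exponent p"
  shows "gamma_const n p > 0"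
    and "ln (gamma_const n p) = ln n + (p - 1) * (ln q + 1) + p / 2 * ln pi
      - p / n * (ln (Gamma (n / 2 + 1)) - ln (Gamma (n / q + 1)))"
proof -
  have q: "q > 1" using conj_exponent_props[OF p] by (simp add: q_def)
  have G: "Gamma (n / 2 + 1) > (0::real)" "Gamma (n / q + 1) > 0"
    using q by (intro Gamma_real_pos add_nonneg_pos; simp)+
  define a b where "a = Gamma (n / 2 + 1)" and "b = Gamma (n / q + 1)"
  have ab: "a > 0" "b > 0" using G by (simp_all add: a_def b_def)
  have eq: "gamma_const n p = n * (q * exp 1) powr (p - 1) * pi powr (p / 2) * (a / b) powr (- (p / n))"
    by (simp add: gamma_const_def q_def[symmetric] Let_def a_def b_def)
  show "gamma_const n p > 0"
    using ab n q by (simp add: eq)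
  show "ln (gamma_const n p) = ln n + (p - 1) * (ln q + 1) + p / 2 * ln pi
      - p / n * (ln (Gamma (n / 2 + 1)) - ln (Gamma (n / q + 1)))"
    unfolding a_def[symmetric] b_def[symmetric] eq
    using ab n q by (simp add: ln_mult ln_powr ln_div)
qed

text \<open>The right-hand side of \<open>le\<close> has the form \<open>n + L + n * ln s\<close>,
  so the hypothesis is a family of bounds in s, and its sharpest member is the claim in logarithmic
  form.\<close>

lemma entropy_Fisher_optimise:
  fixes H F p :: real and n :: nat
  assumes p: "p > 1" and n: "n > 0" and F: "F \<ge> 0"
  defines "q \<equiv> conj_exponent p"
  assumes le: "\<And>s. s > 0 \<Longrightarrow> s powr p / p * F + H \<ge> n +
      ln (unit_ball_vol n * (1 / (q * s powr q)) powr (- (n / q)) * Gamma (n / q + 1))"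
  shows "exp (p / n * H) * F \<ge> gamma_const n p"
proof -
  have q: "q > 1" and pq: "p / q = p - 1"
    using conj_exponent_props[OF p] by (simp_all add: q_def)
  have G: "Gamma (n / 2 + 1) > (0::real)" "Gamma (n / q + 1) > 0"
    using q by (intro Gamma_real_pos add_nonneg_pos; simp)+
  define a b where "a = Gamma (n / 2 + 1)" and "b = Gamma (n / q + 1)"
  have ab: "a > 0" "b > 0" using G by (simp_all add: a_def b_def)
  define L where "L = n / 2 * ln pi - ln a + n / q * ln q + ln b"
  have le': "s powr p / p * F + H \<ge> n + (L + n * ln s)" if s: "s > 0" for s
  proof -
    have "ln (unit_ball_vol n * (1 / (q * s powr q)) powr (- (n / q)) * Gamma (n / q + 1)) = L + n * ln s"
      unfolding unit_ball_vol_def a_def[symmetric] b_def[symmetric] L_def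
      using s q ab by (simp add: ln_mult ln_div ln_powr field_simps)
    with le[OF s] show ?thesis by simp
  qed
  have "F \<noteq> 0"
  proof
    assume "F = 0"
    \<comment> \<open>For \<open>F = 0\<close> the left-hand side is \<open>H\<close> for every s,
      while at this s the right-hand side is \<open>H + 1\<close>.\<close>
    then show False using le'[of "exp ((H - n - L + 1) / n)"] n by simp
  qed
  with F have Fpos: "F > 0" by simp
  \<comment> \<open>The stationary point of \<open>s powr p / p * F - n * ln s\<close>. For the
    extremal function \<open>F = n / p\<close>, so \<open>s powr p = p\<close>, and the weight with
    rate \<open>1 / (q * s powr q)\<close> is then proportional to \<open>G_tilde p\<close> raised
    to p - 1.\<close>
  define s where "s = (n / F) powr (1 / p)"
  have s: "s > 0" "s powr p = n / F" "ln s = (ln n - ln F) / p"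
    using Fpos n p by (auto simp: s_def powr_powr ln_powr ln_div)
  have "n / p + H \<ge> n + (L + n * ((ln n - ln F) / p))"
    using le'[OF s(1)] Fpos unfolding s(2,3) by (simp add: mult.commute)
  then have "p / n * (n + (L + n * ((ln n - ln F) / p))) \<le> p / n * (n / p + H)"
    using p by (intro mult_left_mono) auto
  moreover have "p / n * (n / p + H) = 1 + p / n * H"
    using n p by (simp add: field_simps)
  moreover have "p / n * (n + (L + n * ((ln n - ln F) / p))) = p + p / n * L + ln n - ln F"
    using n p by (simp add: field_simps)
  ultimately have "1 + p / n * H \<ge> p + p / n * L + ln n - ln F" by simp
  moreover have "p / n * L = p / 2 * ln pi - p / n * ln a + (p - 1) * ln q + p / n * ln b"
    unfolding L_def pq[symmetric] using n by (simp add: field_simps)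
  ultimately have "ln (gamma_const n p) \<le> p / n * H + ln F"
    unfolding ln_gamma_const(2)[OF p n] q_def[symmetric] a_def[symmetric] b_def[symmetric]
    by (simp add: algebra_simps)
  then have "exp (ln (gamma_const n p)) \<le> exp (p / n * H + ln F)" by simp
  then show ?thesis using ln_gamma_const(1)[OF p n] Fpos by (simp add: exp_add)
qed

subsection \<open>The extremal function and the inequality\<close>

lemma C_const_pos:
  assumes "p > 1" and "n > 0"
  shows "C_const p n > 0"
proof -
  have q: "conj_exponent p > 1" using conj_exponent_props[OF assms(1)] by simp
  have "Gamma (n / 2 + 1) > (0::real)" "Gamma (n / conj_exponent p + 1) > 0"
    using q by (intro Gamma_real_pos add_nonneg_pos; simp)+
  then have "Gamma (n / 2 + 1) / Gamma (n / conj_exponent p + 1) > 0" by (rule divide_pos_pos)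
  moreover have "(p powr (1 / p) * conj_exponent p powr (1 / conj_exponent p)) powr (- real n) > 0"
    using q assms by simp
  ultimately show ?thesis unfolding C_const_def Let_def by (intro mult_pos_pos) simp_all
qed

text \<open>The bracket in the first identity is the integral of
  \<open>exp (- k * norm x powr q)\<close>, so \<open>C_const\<close> makes \<open>G_tilde p\<close>
  raised to p - 1 a probability density. In the second, \<open>n / p\<close> is the Fisher
  information of \<open>G_tilde p\<close> and the other two factors form its entropy power.\<close>

lemma C_const_normalises:
  assumes p: "p > 1" and n: "n > 0"
  defines "q \<equiv> conj_exponent p"
  defines "k \<equiv> (p - 1) / p powr q"
  shows "C_const p n * (unit_ball_vol n * k powr (- (n / q)) * Gamma (n / q + 1)) = 1"
    and "C_const p n powr (- (p / n)) * (n / p) * exp (p - 1) = gamma_const n p"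
proof -
  have q: "q > 1" and pq: "p / q = p - 1" and q1: "1 / p + 1 / q = 1" "q * (p - 1) = p"
    using conj_exponent_props[OF p] by (simp_all add: q_def)
  have G: "Gamma (n / 2 + 1) > (0::real)" "Gamma (n / q + 1) > 0"
    using q by (intro Gamma_real_pos add_nonneg_pos; simp)+
  define a b where "a = Gamma (n / 2 + 1)" and "b = Gamma (n / q + 1)"
  have ab: "a > 0" "b > 0" using G by (simp_all add: a_def b_def)
  have C: "C_const p n = (p powr (1 / p) * q powr (1 / q)) powr (- real n) * pi powr (- (n / 2)) * (a / b)"
    by (simp add: C_const_def Let_def q_def[symmetric] a_def b_def)
  have lnC: "ln (C_const p n) = - n * (ln p / p + ln q / q) - n / 2 * ln pi + ln a - ln b"
    unfolding C using p q ab by (simp add: ln_mult ln_powr ln_div)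
  have Cpos: "C_const p n > 0" by (rule C_const_pos[OF p n])
  have lnk: "ln k = ln (p - 1) - q * ln p" unfolding k_def using p by (simp add: ln_div ln_powr)
  have lnq: "ln q = ln p - ln (p - 1)" using p by (simp add: q_def conj_exponent_def ln_div)
  have kpos: "k > 0" using p by (simp add: k_def)
  \<comment> \<open>Conjugacy multiplied by \<open>ln p\<close>: this cancels the powers of p in
    \<open>C_const\<close> against those in \<open>k\<close>.\<close>
  have lnp: "ln p = ln p / p + ln p / q" using q1(1) by (metis distrib_left mult.right_neutral times_divide_eq_right)
  define X where "X = C_const p n * (unit_ball_vol n * k powr (- (n / q)) * Gamma (n / q + 1))"
  have "ln X = ln (C_const p n) + n / 2 * ln pi - ln a + (- (n / q)) * ln k + ln b"
    unfolding X_def unit_ball_vol_def a_def[symmetric] b_def[symmetric]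
    using ab kpos Cpos by (simp add: ln_mult ln_powr ln_div)
  also have "\<dots> = n * (ln p - (ln p / p + ln p / q))"
    unfolding lnC lnk lnq using q by (simp add: field_simps)
  also have "\<dots> = 0" using lnp by simp
  finally have "ln X = 0" .
  moreover have "X > 0" unfolding X_def using Cpos kpos G by simp
  ultimately show "C_const p n * (unit_ball_vol n * k powr (- (n / q)) * Gamma (n / q + 1)) = 1"
    by (simp add: X_def[symmetric])
  have "ln (C_const p n powr (- (p / n)) * (n / p) * exp (p - 1)) = - (p / n) * ln (C_const p n) + ln n - ln p + (p - 1)"
    using Cpos n p by (simp add: ln_mult ln_powr ln_div)
  also have "- (p / n) * ln (C_const p n) = ln p + p / q * ln q + p / 2 * ln pi - p / n * (ln a - ln b)"
    unfolding lnC using n p q by (simp add: field_simps)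
  also have "ln p + p / q * ln q + p / 2 * ln pi - p / n * (ln a - ln b) + ln n - ln p + (p - 1) = ln (gamma_const n p)"
    unfolding ln_gamma_const(2)[OF p n] q_def[symmetric] a_def[symmetric] b_def[symmetric] pq
    by (simp add: algebra_simps)
  finally have "ln (C_const p n powr (- (p / n)) * (n / p) * exp (p - 1)) = ln (gamma_const n p)" .
  then show "C_const p n powr (- (p / n)) * (n / p) * exp (p - 1) = gamma_const n p"
    using Cpos n p ln_gamma_const(1)[OF p n] by (subst (asm) ln_inj_iff) auto
qed

text \<open>Both values reduce to the mass and the q-th moment of
  \<open>exp (- k * norm x powr q)\<close>. The logarithm of the density is affine in
  \<open>norm x powr q\<close>, and the Fisher integrand is a multiple of
  \<open>norm x powr q\<close> times the density because (q - 1) p = q.\<close>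

lemma
  fixes p :: real
  assumes p: "p > 1"
  defines "n \<equiv> CARD('n::finite)" and "q \<equiv> conj_exponent p"
  shows p_entropy_G_tilde: "p_entropy p (G_tilde p :: real^'n \<Rightarrow> real) = - ln (C_const p n) + n / q"
    and p_Fisher_G_tilde: "p_Fisher p (G_tilde p :: real^'n \<Rightarrow> real) = ennreal (n / p)"
proof -
  define C where "C = C_const p n"
  define k where "k = (p - 1) / p powr q"
  define G :: "real^'n \<Rightarrow> real" where "G = G_tilde p"
  have n: "n > 0" by (simp add: n_def)
  have q: "q > 1" and qp: "(q - 1) * p = q" "q * (p - 1) = p"
    using conj_exponent_props[OF p] by (simp_all add: q_def)
  have Cpos: "C > 0" unfolding C_def by (rule C_const_pos[OF p n])
  have kpos: "k > 0" using p by (simp add: k_def)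
  have G: "G x = (C * exp (- k * norm x powr q)) powr (1 / (p - 1))" for x
    by (simp add: G_def G_tilde_def Let_def C_def k_def q_def n_def)
  have Gpow: "G x powr (p - 1) = C * exp (- k * norm x powr q)" for x
    unfolding G using p Cpos by (simp add: powr_powr)
  have Gpos: "G x > 0" for x unfolding G using Cpos by simp
  define Z where "Z = unit_ball_vol n * k powr (- (n / q)) * Gamma (n / q + 1)"
  have CZ: "C * Z = 1"
    using C_const_normalises(1)[OF p n] by (simp add: C_def Z_def k_def q_def)
  have 0: "has_bochner_integral lborel (\<lambda>x::real^'n. exp (- k * norm x powr q)) Z"
    using has_bochner_integral_exp_norm_powr[OF kpos, of q, where 'a = "real^'n"] q by (simp add: n_def Z_def)
  have 1: "has_bochner_integral lborel (\<lambda>x::real^'n. norm x powr q * exp (- k * norm x powr q)) (n / (q * k) * Z)"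
    using has_bochner_integral_norm_powr_exp[OF kpos, of q, where 'a = "real^'n"] q by (simp add: n_def Z_def)
  have "has_bochner_integral lborel (\<lambda>x. C * ln C * exp (- k * norm x powr q)
      - C * k * (norm x powr q * exp (- k * norm (x::real^'n) powr q))) (C * ln C * Z - C * k * (n / (q * k) * Z))"
    by (intro has_bochner_integral_diff has_bochner_integral_mult_right 0 1)
  moreover have "C * ln C * exp (- k * norm x powr q) - C * k * (norm x powr q * exp (- k * norm (x::real^'n) powr q))
      = G x powr (p - 1) * ln (G x powr (p - 1))" for x
    unfolding Gpow using Cpos by (simp add: ln_mult algebra_simps)
  ultimately have "has_bochner_integral lborel (\<lambda>x. G x powr (p - 1) * ln (G x powr (p - 1)))
      (C * ln C * Z - C * k * (n / (q * k) * Z))" by simp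
  then have "p_entropy p G = - (C * ln C * Z - C * k * (n / (q * k) * Z))"
    unfolding p_entropy_def by (simp add: has_bochner_integral_integral_eq)
  also have "\<dots> = - (C * Z) * ln C + (C * Z) * (n / q)"
    using kpos by (simp add: algebra_simps)
  finally show "p_entropy p (G_tilde p :: real^'n \<Rightarrow> real) = - ln (C_const p n) + n / q"
    unfolding CZ by (simp add: G_def C_def)
  define j where "j = k / (p - 1)"
  define d where "d = j * q"
  have dpos: "d > 0" using p q kpos by (simp add: d_def j_def)
  \<comment> \<open>The origin is excluded because the chain rule through the norm fails there; it
    is a null set.\<close>
  have grad: "norm (gradient G x) powr p / G x = C * d powr p * (norm x powr q * exp (- k * norm x powr q))"
    if x: "x \<noteq> 0" for x
  proof -
    define g where "g = (\<lambda>r. C powr (1 / (p - 1)) * exp (- j * r powr q))"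
    have Gg: "G y = g (norm y)" for y
      unfolding G g_def j_def using Cpos p by (simp add: powr_mult exp_powr_real)
    have "((\<lambda>r. g r) has_real_derivative - (d * norm x powr (q - 1)) * g (norm x)) (at (norm x))"
      unfolding g_def d_def using x by (auto intro!: derivative_eq_intros)
    from GDERIV_DERIV_compose[OF GDERIV_norm[OF x] this]
    have "GDERIV G x :> (- (d * norm x powr (q - 1)) * g (norm x)) *\<^sub>R sgn x"
      by (simp add: Gg[abs_def])
    then have "norm (gradient G x) = d * norm x powr (q - 1) * G x"
      using x dpos Gpos[of x] by (simp add: gradient_eqI Gg abs_mult norm_sgn)
    then have "norm (gradient G x) powr p / G x = d powr p * norm x powr ((q - 1) * p) * (G x powr p / G x powr 1)"
      using dpos Gpos[of x] by (simp add: powr_mult powr_powr less_imp_le)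
    also have "G x powr p / G x powr 1 = G x powr (p - 1)" by (simp add: powr_diff)
    finally show ?thesis unfolding qp Gpow by (simp add: ac_simps)
  qed
  have "(\<integral>\<^sup>+x. ennreal (norm (gradient G x) powr p / G x) \<partial>lborel)
     = (\<integral>\<^sup>+x. ennreal (C * d powr p * (norm x powr q * exp (- k * norm (x::real^'n) powr q))) \<partial>lborel)"
  proof (rule nn_integral_cong_AE)
    have "AE x in lborel. x \<noteq> (0::real^'n)" by (rule AE_lborel_singleton)
    then show "AE x in lborel. ennreal (norm (gradient G x) powr p / G x)
       = ennreal (C * d powr p * (norm x powr q * exp (- k * norm (x::real^'n) powr q)))"
      by eventually_elim (rule arg_cong[OF grad])
  qed
  also have "\<dots> = ennreal (C * d powr p * (n / (q * k) * Z))"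
    using has_bochner_integral_mult_right[OF 1, of "C * d powr p"] Cpos
    by (subst nn_integral_eq_integral) (auto simp: has_bochner_integral_iff)
  also have "C * d powr p * (n / (q * k) * Z) = d powr p * (n / (q * k)) * (C * Z)" by simp
  finally have "p_Fisher p G = ennreal ((p - 1) powr p) * ennreal (d powr p * (n / (q * k)))"
    by (simp add: p_Fisher_def CZ)
  also have "\<dots> = ennreal ((p - 1) powr p * (d powr p * (n / (q * k))))"
    by (rule ennreal_mult'[symmetric]) simp
  also have "(p - 1) powr p * (d powr p * (n / (q * k))) = n / p"
  proof -
    \<comment> \<open>All factors become powers of p: (p - 1) d = q k = p^(1 - q), whose p-th power
      is p^(-q), and dividing by q k leaves 1 / p.\<close>
    have "q * k = (q * (p - 1)) / p powr q" by (simp add: k_def)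
    then have qk: "q * k = p * p powr (- q)" unfolding qp by (simp add: powr_minus divide_inverse)
    have "(p - 1) * d = q * k" using p by (simp add: d_def j_def)
    also have "\<dots> = p powr (1 - q)" unfolding qk using p by (simp add: powr_diff powr_minus divide_inverse)
    finally have "(p - 1) * d = p powr (1 - q)" .
    then have "(p - 1) powr p * d powr p = p powr ((1 - q) * p)"
      using p dpos by (metis powr_mult powr_powr)
    also have "(1 - q) * p = - q" using qp by (simp add: algebra_simps)
    finally have "(p - 1) powr p * d powr p = p powr (- q)" .
    moreover have "p powr (- q) > 0" using p by simp
    ultimately show ?thesis unfolding qk using p by (simp add: mult.assoc[symmetric])
  qed
  finally show "p_Fisher p (G_tilde p :: real^'n \<Rightarrow> real) = ennreal (n / p)"
    by (simp add: G_def)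
qed

lemma G_tilde_value:
  assumes p: "p > 1"
  shows "ennreal (p_entropy_power p (G_tilde p :: real^'n::finite \<Rightarrow> real)) * p_Fisher p (G_tilde p :: real^'n \<Rightarrow> real)
    = ennreal (gamma_const CARD('n) p)"
proof -
  let ?n = "CARD('n)" and ?q = "conj_exponent p"
  have pq: "p / ?q = p - 1" using conj_exponent_props[OF p] by simp
  have "p_entropy_power p (G_tilde p :: real^'n \<Rightarrow> real) = exp (- (p / ?n) * ln (C_const p ?n) + p / ?q)"
    unfolding p_entropy_power_def p_entropy_G_tilde[OF p] by (simp add: algebra_simps)
  also have "\<dots> = C_const p ?n powr (- (p / ?n)) * exp (p - 1)"
    using C_const_pos[OF p, of ?n] unfolding pq by (simp add: powr_def exp_add[symmetric])
  finally show ?thesis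
    unfolding p_Fisher_G_tilde[OF p] using C_const_normalises(2)[OF p, of ?n] p
    by (simp add: ennreal_mult'[symmetric] ac_simps)
qed

text \<open>If the Fisher information is infinite, the product is infinite because the entropy power
  is positive. If it is finite, its finiteness supplies the integrability of the gradient of the
  density.\<close>

lemma entropy_Fisher_ge:
  fixes u :: "real^'n::finite \<Rightarrow> real" and p :: real
  assumes p: "p > 1" and upos: "\<And>x. u x > 0" and sm: "smooth u" and decay: "rapidly_decaying u"
    and mass: "(\<integral>x. \<bar>u x powr (p - 1)\<bar> \<partial>lborel) = 1"
  shows "ennreal (p_entropy_power p u) * p_Fisher p u \<ge> ennreal (gamma_const CARD('n) p)"
proof (cases "p_Fisher p u = \<infinity>")
  case True
  then show ?thesis by (simp add: p_entropy_power_def ennreal_mult_top)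
next
  case fin: False
  define n where "n = CARD('n)"
  define q where "q = conj_exponent p"
  have q: "q > 1" and q1: "1 / p + 1 / q = 1"
    using conj_exponent_props[OF p] by (simp_all add: q_def)
  define f where "f = (\<lambda>x. u x powr (p - 1))"
  define g where "g = (\<lambda>x. ((p - 1) * u x powr (p - 2)) *\<^sub>R gradient u x)"
  define \<phi> where "\<phi> = (\<lambda>x. (p - 1) powr p * (norm (gradient u x) powr p / u x))"
  have ucont: "continuous_on UNIV u"
    using smooth_gradient[OF sm] by (meson continuous_at_imp_continuous_on has_derivative_continuous)
  have um[measurable]: "u \<in> borel_measurable borel" by (rule borel_measurable_continuous_onI[OF ucont])
  have gradm[measurable]: "gradient u \<in> borel_measurable borel"
    by (rule borel_measurable_continuous_onI[OF smooth_continuous_gradient[OF sm]])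
  have fpos: "f x > 0" for x unfolding f_def using upos[of x] by simp
  have f1: "(\<integral>x. f x \<partial>lborel) = 1" using mass by (simp add: f_def)
  \<comment> \<open>A non-integrable function has Bochner integral 0, so the value 1 entails
    integrability.\<close>
  then have f: "integrable lborel f" using not_integrable_integral_eq by fastforce
  have df: "(f has_derivative (\<lambda>v. g x \<bullet> v)) (at x)" for x
  proof -
    have "((\<lambda>t. t powr (p - 1)) has_real_derivative (p - 1) * u x powr (p - 1 - 1)) (at (u x))"
      using upos[of x] by (rule has_real_derivative_powr)
    from has_derivative_compose[OF smooth_gradient[OF sm, of x] this[unfolded has_field_derivative_def]]
    show ?thesis by (simp add: f_def g_def)
  qed
  have gcont: "continuous_on UNIV g"
    unfolding g_def using upos
    by (intro continuous_intros smooth_continuous_gradient[OF sm] ucont) (auto simp: less_imp_neq[symmetric])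
  have gm[measurable]: "g \<in> borel_measurable borel" by (rule borel_measurable_continuous_onI[OF gcont])
  have \<phi>0: "\<phi> x \<ge> 0" for x unfolding \<phi>_def using upos[of x] by simp
  have \<phi>_eq: "\<phi> x = f x * (norm (g x) / f x) powr p" for x
  proof -
    have "norm (g x) / f x = (p - 1) * norm (gradient u x) * u x powr (- 1)"
      using p upos[of x] by (simp add: g_def f_def powr_diff powr_minus field_simps power2_eq_square)
    then have "f x * (norm (g x) / f x) powr p
        = (p - 1) powr p * norm (gradient u x) powr p * (u x powr (p - 1) * u x powr (- p))"
      unfolding f_def by (simp only: powr_mult powr_powr mult_minus1 mult_minus1_right ac_simps)
    also have "u x powr (p - 1) * u x powr (- p) = 1 / u x"
      using upos[of x] by (simp add: powr_diff powr_minus field_simps)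
    finally show ?thesis by (simp add: \<phi>_def)
  qed
  have Fisher: "p_Fisher p u = (\<integral>\<^sup>+x. ennreal (\<phi> x) \<partial>lborel)"
    unfolding p_Fisher_def \<phi>_def by (simp add: nn_integral_cmult[symmetric] ennreal_mult'[symmetric])
  have \<phi>: "integrable lborel \<phi>"
    using fin \<phi>0 unfolding Fisher by (intro integrableI_nonneg) (auto simp: \<phi>_def less_top)
  define F where "F = (\<integral>x. \<phi> x \<partial>lborel)"
  have F0: "F \<ge> 0" unfolding F_def using \<phi>0 by simp
  have FF: "p_Fisher p u = ennreal F"
    unfolding Fisher F_def using \<phi> \<phi>0 by (intro nn_integral_eq_integral) auto
  \<comment> \<open>Decay of \<open>u\<close> gives no direct bound, since for p < 2 the factor
    \<open>u x powr (p - 2)\<close> is unbounded. Instead \<open>a \<le> 1 + a powr p\<close> at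
    \<open>a = norm (g x) / f x\<close> bounds \<open>norm (g x)\<close> by
    \<open>f x + \<phi> x\<close>.\<close>
  have g: "integrable lborel g"
  proof (rule Bochner_Integration.integrable_bound)
    show "integrable lborel (\<lambda>x. f x + \<phi> x)" using f \<phi> by simp
    show "AE x in lborel. norm (g x) \<le> norm (f x + \<phi> x)"
    proof (rule AE_I2)
      fix x
      have "a \<le> 1 + a powr p" if "a \<ge> 0" for a :: real
        using powr_mono[of 1 p a] p that by (cases "a \<le> 1") (auto simp: add_increasing2)
      from mult_left_mono[OF this[of "norm (g x) / f x"], of "f x"]
      have "norm (g x) \<le> f x + \<phi> x" using fpos[of x] unfolding \<phi>_eq by (simp add: distrib_left)
      then show "norm (g x) \<le> norm (f x + \<phi> x)" by simp
    qed
  qed measurable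
  have ent: "integrable lborel (\<lambda>x. f x * ln (f x))"
    unfolding f_def by (rule integrable_powr_ln_of_decay[OF upos um decay]) (use p in simp)
  have H: "p_entropy p u = - (\<integral>x. f x * ln (f x) \<partial>lborel)" by (simp add: p_entropy_def f_def)
  have "s powr p / p * F + p_entropy p u \<ge> n +
      ln (unit_ball_vol n * (1 / (q * s powr q)) powr (- (n / q)) * Gamma (n / q + 1))" if s: "s > 0" for s
  proof -
    define k where "k = 1 / (q * s powr q)"
    have k: "k > 0" using s q by (simp add: k_def)
    have "(\<integral>x. s powr p / p * \<phi> x - f x * ln (f x) \<partial>lborel)
        \<ge> real DIM(real^'n) + ln (\<integral>(y::real^'n). exp (- k * norm y powr q) \<partial>lborel)"
    proof (rule dual_entropy_bound_euclidean[OF fpos f f1 df gcont g k])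
      show "s powr p / p * \<phi> x - f x * ln (f x) \<ge> - (y \<bullet> g x) - f x * (k * norm y powr q) - f x * ln (f x)" for x y
      proof -
        define a where "a = norm (g x) / f x"
        have a0: "a \<ge> 0" using fpos[of x] by (simp add: a_def)
        \<comment> \<open>Splitting the product with s before Young's inequality puts
          \<open>s powr p / p\<close> on the Fisher term and the rate \<open>k\<close> on the
          weight.\<close>
        have "a * norm y = (s * a) * (norm y / s)" using s by simp
        also have "\<dots> \<le> (s * a) powr p / p + (norm y / s) powr q / q"
          using p q q1 s a0 by (intro Youngs_inequality) auto
        also have "\<dots> = s powr p / p * a powr p + k * norm y powr q"
          using s a0 by (simp add: k_def powr_mult powr_divide)
        finally have "f x * (a * norm y) \<le> f x * (s powr p / p * a powr p + k * norm y powr q)"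
          using fpos[of x] by (intro mult_left_mono) auto
        moreover have "- (y \<bullet> g x) \<le> f x * (a * norm y)"
          using Cauchy_Schwarz_ineq2[of y "g x"] fpos[of x] by (simp add: a_def mult.commute)
        ultimately show ?thesis unfolding \<phi>_eq a_def[symmetric] by (simp add: algebra_simps)
      qed
    qed (use q \<phi> ent in auto)
    also have "(\<integral>(y::real^'n). exp (- k * norm y powr q) \<partial>lborel)
        = unit_ball_vol n * k powr (- (n / q)) * Gamma (n / q + 1)"
      using has_bochner_integral_integral_eq[OF has_bochner_integral_exp_norm_powr[OF k, of q, where 'a = "real^'n"]] q
      by (simp add: n_def)
    finally show ?thesis using \<phi> ent by (simp add: H F_def k_def n_def)
  qed
  from entropy_Fisher_optimise[OF p _ F0 this[unfolded q_def]]
  have "gamma_const n p \<le> p_entropy_power p u * F"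
    by (simp add: n_def p_entropy_power_def)
  then show ?thesis unfolding FF
    by (subst ennreal_mult'[symmetric]) (auto simp: n_def p_entropy_power_def intro: ennreal_leI)
qed

theorem theorem1p3:
  fixes u :: "real^'n::finite \<Rightarrow> real" and p :: real
  assumes "p > 1"
    and "\<And>x. u x > 0"
    and "smooth u"
    and "rapidly_decaying u"
    and "(\<integral>x. \<bar>u x powr (p - 1)\<bar> \<partial>lborel) = 1"
  shows "ennreal (p_entropy_power p u) * p_Fisher p u
           \<ge> ennreal (p_entropy_power p (G_tilde p :: real^'n \<Rightarrow> real))
             * p_Fisher p (G_tilde p :: real^'n \<Rightarrow> real)
         \<and> ennreal (p_entropy_power p (G_tilde p :: real^'n \<Rightarrow> real))
             * p_Fisher p (G_tilde p :: real^'n \<Rightarrow> real)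
           = ennreal (gamma_const CARD('n) p)"
  using entropy_Fisher_ge[OF assms] G_tilde_value[OF assms(1), where 'n = 'n] by simp

end
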